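(* Let $a,b>0$, let $(X,d)$ be a locally compact Polish metric space, let $k\ge2$ be an integer, let $\mu_1,\dots,\mu_k\in\mathcal{M}(X)$ have compact supports, and let $\lambda_1,\dots,\lambda_k$ be positive real numbers with $\sum_{i=1}^k\lambda_i=1$. Let $K=\bigcup_{i=1}^k\mathrm{supp}(\mu_i)$. Then the problem $$(B)\qquad \inf\left\{\sum_{i=1}^k\lambda_i\,\widetilde{W}^{a,b}_2(\mu_i,\mu)^2 : \mu\in\mathcal{M}(X),\ \mathrm{supp}(\mu)\subset K\right\}$$ has a solution, i.e. the infimum is attained.
   Context: $\mathcal{M}(X)$ is the set of nonnegative finite Borel measures on $X$; $\mathcal{M}_2(X)$ is the subset of those with finite second moment, i.e. $\int_X d^2(x,x_0)\,d\mu(x)<\infty$ for some $x_0\in X$. For a finite signed Borel measure $\mu=\mu^+-\mu^-$, $|\mu|:=\mu^+(X)+\mu^-(X)$. For $\mu_1,\mu_2\in\mathcal{M}_2(X)$ with $|\mu_1|=|\mu_2|$, $W_2(\mu_1,\mu_2):=\left(|\mu_1|\inf_{\boldsymbol\pi\in\Pi(\mu_1,\mu_2)}\int_{X\times X}d^2(x,y)\,d\boldsymbol\pi(x,y)\right)^{1/2}$, where $\Pi(\mu_1,\mu_2)$ is the set of Borel probability measures $\boldsymbol\pi$ on $X\times X$ with $|\mu_1|\boldsymbol\pi(A\times X)=\mu_1(A)$ and $|\mu_2|\boldsymbol\pi(X\times B)=\mu_2(B)$ for all Borel $A,B$. The generalized Wasserstein distance is $$\widetilde{W}^{a,b}_2(\mu_1,\mu_2):=\left(\inf\left\{a|\mu_1-\widetilde\mu_1|+a|\mu_2-\widetilde\mu_2|+b^2W_2^2(\widetilde\mu_1,\widetilde\mu_2):\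 \widetilde\mu_1,\widetilde\mu_2\in\mathcal{M}_2(X),\ |\widetilde\mu_1|=|\widetilde\mu_2|\right\}\right)^{1/2},\quad \mu_1,\mu_2\in\mathcal{M}(X).$$ *)

theory Defs
  imports "HOL-Probability.Probability"
begin

definition borel_measures :: "'a::metric_space measure set" where
  "borel_measures = {\<mu>. sets \<mu> = sets borel \<and> finite_measure \<mu>}"

definition borel_measures_2 :: "'a::metric_space measure set" where
  "borel_measures_2 =
     {\<mu> \<in> borel_measures. \<exists>x0. (\<integral>\<^sup>+ x. ennreal ((dist x x0)\<^sup>2) \<partial>\<mu>) < \<infinity>}"

definition msupport :: "'a::metric_space measure \<Rightarrow> 'a set" where
  "msupport \<mu> = {x. \<forall>U. open U \<longrightarrow> x \<in> U \<longrightarrow> emeasure \<mu> U > 0}"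

text \<open>A finite signed Borel measure is represented by its set function \<open>\<nu>\<close>; only the values
  on Borel sets matter. Its Jordan decomposition consists of two mutually singular finite
  measures, and its total mass is \<open>\<nu>\<^sup>+(X) + \<nu>\<^sup>-(X)\<close>.\<close>

definition jordan_decomposition ::
    "('a::metric_space set \<Rightarrow> real) \<Rightarrow> 'a measure \<Rightarrow> 'a measure \<Rightarrow> bool" where
  "jordan_decomposition \<nu> P Q \<longleftrightarrow>
     P \<in> borel_measures \<and> Q \<in> borel_measures \<and>
     (\<forall>A\<in>sets borel. \<nu> A = measure P A - measure Q A) \<and>
     (\<exists>D\<in>sets borel. measure P D = 0 \<and> measure Q (- D) = 0)"

definition total_mass :: "('a::metric_space set \<Rightarrow> real) \<Rightarrow> real" where
  "total_mass \<nu> =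
     (THE r. \<exists>P Q. jordan_decomposition \<nu> P Q \<and> r = measure P UNIV + measure Q UNIV)"

lemma borel_measuresD:
  assumes "\<mu> \<in> borel_measures"
  shows "sets \<mu> = sets borel" "space \<mu> = UNIV" "finite_measure \<mu>"
  using assms sets_eq_imp_space_eq[of \<mu> borel] by (auto simp: borel_measures_def)

lemma jordan_decomposition_le:
  assumes "jordan_decomposition \<nu> P Q" "jordan_decomposition \<nu> P' Q'"
  shows "measure P UNIV + measure Q UNIV \<le> measure P' UNIV + measure Q' UNIV"
proof -
  obtain D where D: "D \<in> sets borel" "measure P D = 0" "measure Q (- D) = 0"
    using assms(1) by (auto simp: jordan_decomposition_def)
  have D': "- D \<in> sets borel"
    using D(1) by (simp add: borel_comp)
  have M: "P \<in> borel_measures" "Q \<in> borel_measures"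
      "P' \<in> borel_measures" "Q' \<in> borel_measures"
    and eq: "\<And>A. A \<in> sets borel \<Longrightarrow>
        measure P A - measure Q A = measure P' A - measure Q' A"
    using assms by (auto simp: jordan_decomposition_def)
  have split: "measure R UNIV = measure R D + measure R (- D)" if "R \<in> borel_measures" for R
    using finite_measure.finite_measure_Union[OF borel_measuresD(3)[OF that], of D "- D"]
      D(1) D' by (simp add: borel_measuresD[OF that])
  have "measure P (- D) \<le> measure P' (- D)"
    using eq[OF D'] D(3) measure_nonneg[of Q' "- D"] by linarith
  moreover have "measure Q D \<le> measure Q' D"
    using eq[OF D(1)] D(2) measure_nonneg[of P' D] by linarith
  ultimately show ?thesis
    using split[OF M(1)] split[OF M(2)] split[OF M(3)] split[OF M(4)] D(2,3)
      measure_nonneg[of P' D] measure_nonneg[of Q' "- D"] by linarith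
qed

lemma total_mass_eq:
  assumes "jordan_decomposition \<nu> P Q"
  shows "total_mass \<nu> = measure P UNIV + measure Q UNIV"
  unfolding total_mass_def
  by (rule the_equality) (use assms in \<open>auto intro: antisym jordan_decomposition_le\<close>)

lemma jordan_decomposition_exists:
  assumes "\<mu> \<in> borel_measures" "\<mu>' \<in> borel_measures"
  shows "\<exists>P Q. jordan_decomposition (\<lambda>A. measure \<mu> A - measure \<mu>' A) P Q"
proof -
  note B = borel_measuresD[OF assms(1)] borel_measuresD[OF assms(2)]
  have sub: "\<exists>R\<in>borel_measures. \<forall>A\<in>sets borel.
      measure R A = measure N (A \<inter> Y) - measure L (A \<inter> Y)"
    if N: "N \<in> borel_measures" and L: "L \<in> borel_measures" and Y: "Y \<in> sets borel"
      and le: "\<And>X. X \<in> sets borel \<Longrightarrow> X \<subseteq> Y \<Longrightarrow> emeasure L X \<le> emeasure N X"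
    for N L :: "'a measure" and Y
  proof -
    note BN = borel_measuresD[OF N] and BL = borel_measuresD[OF L]
    interpret N: finite_measure N by fact
    interpret L: finite_measure L by fact
    define N' where "N' = density N (indicator Y)"
    define L' where "L' = density L (indicator Y)"
    define R where "R = diff_measure N' L'"
    have s: "sets N' = sets borel" "sets L' = sets borel"
      by (simp_all add: N'_def L'_def BN BL)
    have eN: "emeasure N' A = emeasure N (A \<inter> Y)" if "A \<in> sets borel" for A
      using that Y BN by (simp add: N'_def emeasure_restricted Int_commute)
    have eL: "emeasure L' A = emeasure L (A \<inter> Y)" if "A \<in> sets borel" for A
      using that Y BL by (simp add: L'_def emeasure_restricted Int_commute)
    have f: "finite_measure N'" "finite_measure L'"
      using s[THEN sets_eq_imp_space_eq] eN[of UNIV] eL[of UNIV] by (auto intro!: finite_measureI)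
    have eR: "emeasure R A = emeasure N (A \<inter> Y) - emeasure L (A \<inter> Y)"
      if "A \<in> sets borel" for A
      unfolding R_def
      by (subst emeasure_diff_measure) (use f s that le Y in \<open>auto simp: eN eL\<close>)
    have sR: "sets R = sets borel"
      unfolding R_def by (simp add: s)
    have "measure R A = measure N (A \<inter> Y) - measure L (A \<inter> Y)" if "A \<in> sets borel" for A
    proof -
      have "emeasure L (A \<inter> Y) \<le> emeasure N (A \<inter> Y)"
        using le that Y by auto
      then show ?thesis
        unfolding measure_def[of R] eR[OF that]
        by (simp add: N.emeasure_eq_measure L.emeasure_eq_measure ennreal_minus)
    qed
    moreover have "finite_measure R"
      using eR[of UNIV] sets_eq_imp_space_eq[OF sR]
      by (auto intro!: finite_measureI simp: N.emeasure_eq_measure L.emeasure_eq_measure ennreal_minus)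
    ultimately show ?thesis
      using sR by (auto simp: borel_measures_def)
  qed
  obtain Y where Y: "Y \<in> sets borel"
    and Y1: "\<And>X. X \<in> sets borel \<Longrightarrow> X \<subseteq> Y \<Longrightarrow> emeasure \<mu>' X \<le> emeasure \<mu> X"
    and Y2: "\<And>X. X \<in> sets borel \<Longrightarrow> X \<inter> Y = {} \<Longrightarrow> emeasure \<mu> X \<le> emeasure \<mu>' X"
    using finite_unsigned_Hahn_decomposition[of \<mu> \<mu>'] B by auto
  have Y': "- Y \<in> sets borel"
    using Y by (simp add: borel_comp)
  obtain P where P: "P \<in> borel_measures"
    "\<And>A. A \<in> sets borel \<Longrightarrow> measure P A = measure \<mu> (A \<inter> Y) - measure \<mu>' (A \<inter> Y)"
    using sub[OF assms Y Y1] by blast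
  obtain Q where Q: "Q \<in> borel_measures"
    "\<And>A. A \<in> sets borel \<Longrightarrow> measure Q A = measure \<mu>' (A \<inter> - Y) - measure \<mu> (A \<inter> - Y)"
    using sub[OF assms(2,1) Y'] Y2 by blast
  have split: "measure R A = measure R (A \<inter> Y) + measure R (A \<inter> - Y)"
    if "R \<in> borel_measures" "A \<in> sets borel" for R A
  proof -
    have "measure R ((A \<inter> Y) \<union> (A \<inter> - Y)) = measure R (A \<inter> Y) + measure R (A \<inter> - Y)"
      using that Y Y' borel_measuresD[OF that(1)]
      by (intro finite_measure.finite_measure_Union) auto
    moreover have "(A \<inter> Y) \<union> (A \<inter> - Y) = A" by auto
    ultimately show ?thesis by simp
  qed
  have "measure P (- Y) = 0" "measure Q (- (- Y)) = 0"
    using P(2)[OF Y'] Q(2)[OF Y] by simp_all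
  moreover have "measure \<mu> A - measure \<mu>' A = measure P A - measure Q A"
    if "A \<in> sets borel" for A
    using P(2)[OF that] Q(2)[OF that] split[OF assms(1) that] split[OF assms(2) that] by linarith
  ultimately have "jordan_decomposition (\<lambda>A. measure \<mu> A - measure \<mu>' A) P Q"
    unfolding jordan_decomposition_def using P(1) Q(1) Y' by blast
  then show ?thesis by blast
qed

lemma total_mass_measure:
  assumes "\<mu> \<in> borel_measures"
  shows "total_mass (measure \<mu>) = measure \<mu> UNIV"
proof -
  have "jordan_decomposition (measure \<mu>) \<mu> (null_measure borel)"
    unfolding jordan_decomposition_def
  proof (intro conjI ballI)
    show "null_measure borel \<in> borel_measures"
      by (auto simp: borel_measures_def intro: finite_measureI)
    show "\<exists>D\<in>sets borel. measure \<mu> D = 0 \<and> measure (null_measure borel) (- D) = 0"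
      by (rule bexI[of _ "{}"]) simp_all
  qed (use assms in simp_all)
  from total_mass_eq[OF this] show ?thesis by simp
qed

text \<open>For a nonnegative measure \<open>\<mu>\<close> the mass is simply \<open>measure \<mu> UNIV\<close>
  (lemma \<open>total_mass_measure\<close>). If the common mass is zero, the marginal conditions on a
  transference plan are void.\<close>

definition transport_plans ::
    "'a::metric_space measure \<Rightarrow> 'a measure \<Rightarrow> ('a \<times> 'a) measure set" where
  "transport_plans \<mu>1 \<mu>2 =
     {\<pi>. sets \<pi> = sets borel \<and> prob_space \<pi> \<and>
        (\<forall>A\<in>sets borel. measure \<mu>1 UNIV * measure \<pi> (A \<times> UNIV) = measure \<mu>1 A) \<and>
        (\<forall>B\<in>sets borel. measure \<mu>2 UNIV * measure \<pi> (UNIV \<times> B) = measure \<mu>2 B)}"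

text \<open>Meaningful for measures in \<open>borel_measures_2\<close> of equal mass. There the infimum is
  finite, so that \<open>enn2real\<close> loses no information.\<close>

definition W2 :: "'a::metric_space measure \<Rightarrow> 'a measure \<Rightarrow> real" where
  "W2 \<mu>1 \<mu>2 =
     sqrt (measure \<mu>1 UNIV *
       enn2real (INF \<pi>\<in>transport_plans \<mu>1 \<mu>2. \<integral>\<^sup>+ (x, y). ennreal ((dist x y)\<^sup>2) \<partial>\<pi>))"

definition generalized_W2 ::
    "real \<Rightarrow> real \<Rightarrow> 'a::metric_space measure \<Rightarrow> 'a measure \<Rightarrow> real" where
  "generalized_W2 a b \<mu>1 \<mu>2 =
     sqrt (Inf {a * total_mass (\<lambda>A. measure \<mu>1 A - measure \<mu>1' A)
              + a * total_mass (\<lambda>A. measure \<mu>2 A - measure \<mu>2' A)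
              + b\<^sup>2 * (W2 \<mu>1' \<mu>2')\<^sup>2 | \<mu>1' \<mu>2'.
            \<mu>1' \<in> borel_measures_2 \<and> \<mu>2' \<in> borel_measures_2 \<and>
            measure \<mu>1' UNIV = measure \<mu>2' UNIV})"

end

theory Submission
  imports Defs
begin

text \<open>
  Allowing only \<open>\<mu>\<^sub>1' \<le> \<mu>\<^sub>1\<close> and \<open>\<mu>\<^sub>2' \<le> \<mu>\<^sub>2\<close> does not change the generalized distance, so
  its square is the infimum of the linear functional
  \<open>a (|\<mu>\<^sub>1| + |\<mu>\<^sub>2| - 2 |\<gamma>|) + b\<^sup>2 \<integral> d\<^sup>2 d\<gamma>\<close> over the measures \<open>\<gamma>\<close> on \<open>X \<times> X\<close> whose marginals are
  dominated by \<open>\<mu>\<^sub>1\<close> and \<open>\<mu>\<^sub>2\<close>. For measures on the compact set \<open>K\<close> these \<open>\<gamma>\<close> live on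
  \<open>K \<times> K\<close>, where the functional and the marginal constraints pass to weak limits. The objective
  bounds the masses along a minimizing sequence, so a subsequence converges together with
  near-optimal plans, and its limit is a minimizer. Weak sequential compactness on a compact metric
  space \<open>K\<close> is reduced to Helly's theorem on the real line: \<open>K\<close> has an injective Borel coding
  into a compact set \<open>C\<close> of reals whose inverse extends continuously to \<open>C\<close>.
\<close>

section \<open>Weak sequential compactness on a compact metric space\<close>

text \<open>The plans in \<open>W2\<close> are normalised to probability measures, and when the
  common mass vanishes they carry no information; this is awkward in a limit where mass may
  disappear. An unnormalised plan treats mass zero like any other mass. Moreover, total variation is
  in general only lower semicontinuous under weak convergence. Once the auxiliary measures lie below
  the given ones, the total variation terms become differences of masses, so every term of the cost
  is an integral of a continuous function: the constant 1 or the squared distance. Costs therefore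
  converge along the subsequence, and no semicontinuity argument is needed.

  The coding of \<open>K\<close> takes values in the Cantor set, so it cannot be continuous when
  \<open>K\<close> is connected with more than one point. This is harmless: measures are pushed to
  the line by a Borel map, and only test functions have to be transported continuously, which
  happens through the inverse.\<close>

definition ternary_code :: "(nat \<Rightarrow> bool) \<Rightarrow> real" where
  "ternary_code d = (\<Sum>j. (if d j then 2 else 0) / 3 ^ Suc j)"

lemma sums_ternary_tail: "(\<lambda>i. 2 / 3 ^ Suc (i + m)) sums (1 / 3 ^ m :: real)"
proof -
  have "(\<lambda>i. (2 / 3 ^ Suc m) * (1 / 3) ^ i) sums ((2 / 3 ^ Suc m) * (1 / (1 - 1 / 3 :: real)))"
    by (intro sums_mult geometric_sums) auto
  then show ?thesis
    by (simp add: power_add power_divide field_simps)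
qed

lemma summable_ternary_code: "summable (\<lambda>j. (if d j then 2 else 0) / 3 ^ Suc j :: real)"
  by (rule summable_comparison_test'[OF sums_summable[OF sums_ternary_tail[of 0]], of 0]) auto

lemma ternary_code_bounds: "0 \<le> ternary_code d" "ternary_code d \<le> 1"
proof -
  show "0 \<le> ternary_code d"
    unfolding ternary_code_def by (intro suminf_nonneg summable_ternary_code) auto
  have "ternary_code d \<le> (\<Sum>j. 2 / 3 ^ Suc (j + 0))"
    unfolding ternary_code_def
    by (intro suminf_le summable_ternary_code sums_summable[OF sums_ternary_tail[of 0]]) auto
  then show "ternary_code d \<le> 1"
    using sums_unique[OF sums_ternary_tail[of 0]] by simp
qed

text \<open>At the first differing digit \<open>m\<close> the codes are separated by 2/3^(m+1),
  while all later digits together can recover at most half of this gap. Leaving out the digit 1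
  creates the gap; with binary digits, arbitrarily close or even equal values could have different
  leading digits.\<close>

lemma ternary_code_agree:
  assumes "\<bar>ternary_code d - ternary_code e\<bar> < 1 / 3 ^ Suc n" and "j \<le> n"
  shows "d j = e j"
proof (rule ccontr)
  assume "d j \<noteq> e j"
  define m where "m = (LEAST j. d j \<noteq> e j)"
  have m: "d m \<noteq> e m"
    unfolding m_def by (rule LeastI) fact
  have less: "d i = e i" if "i < m" for i
    using that not_less_Least unfolding m_def by blast
  have "m \<le> n"
    using Least_le[of "\<lambda>j. d j \<noteq> e j", OF \<open>d j \<noteq> e j\<close>] \<open>j \<le> n\<close> by (simp add: m_def)
  define u :: "nat \<Rightarrow> real"
    where "u i = (if d i then 2 else 0) / 3 ^ Suc i - (if e i then 2 else 0) / 3 ^ Suc i" for i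
  have su: "summable u"
    unfolding u_def by (intro summable_diff summable_ternary_code)
  have "ternary_code d - ternary_code e = suminf u"
    unfolding u_def ternary_code_def by (intro suminf_diff summable_ternary_code)
  also have "\<dots> = (\<Sum>i. u (i + Suc m)) + (\<Sum>i<Suc m. u i)"
    by (rule suminf_split_initial_segment[OF su])
  also have "(\<Sum>i<Suc m. u i) = u m"
    by (simp add: less u_def)
  finally have eq: "ternary_code d - ternary_code e = (\<Sum>i. u (i + Suc m)) + u m" .
  have bd: "norm (u (i + Suc m)) \<le> 2 / 3 ^ Suc (i + Suc m)" for i
    by (simp add: u_def)
  have sn: "summable (\<lambda>i. norm (u (i + Suc m)))"
    by (rule summable_comparison_test'[OF sums_summable[OF sums_ternary_tail[of "Suc m"]], of 0])
      (use bd in auto)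
  have "\<bar>\<Sum>i. u (i + Suc m)\<bar> \<le> (\<Sum>i. norm (u (i + Suc m)))"
    using summable_norm[OF sn] by simp
  also have "\<dots> \<le> (\<Sum>i. 2 / 3 ^ Suc (i + Suc m))"
    by (intro suminf_le bd sn sums_summable[OF sums_ternary_tail])
  also have "\<dots> = 1 / 3 ^ Suc m"
    using sums_unique[OF sums_ternary_tail] by metis
  finally have "\<bar>\<Sum>i. u (i + Suc m)\<bar> \<le> 1 / 3 ^ Suc m" .
  moreover have "\<bar>u m\<bar> = 2 * (1 / 3 ^ Suc m)"
    using m by (simp add: u_def)
  ultimately have "1 / 3 ^ Suc m \<le> \<bar>ternary_code d - ternary_code e\<bar>"
    unfolding eq by linarith
  moreover have "(1::real) / 3 ^ Suc n \<le> 1 / 3 ^ Suc m"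
    using \<open>m \<le> n\<close> by (intro divide_left_mono power_increasing) auto
  ultimately show False
    using assms(1) by linarith
qed

text \<open>The code of a point records in which balls of a countable family it lies. Membership in
  a ball is Borel, hence so is \<open>s\<close>. Conversely, close codes share many digits and so
  force the points of \<open>K\<close> to be close, uniformly on \<open>K\<close>. The inverse is
  thus uniformly continuous on the image and extends to its closure \<open>C\<close>; its values
  stay in \<open>K\<close> because \<open>K\<close> is closed.\<close>

lemma compact_borel_code:
  fixes K :: "'a::{complete_space, second_countable_topology} set"
  assumes "compact K" "K \<noteq> {}"
  obtains s :: "'a \<Rightarrow> real" and C :: "real set" and \<phi> :: "real \<Rightarrow> 'a"
  where "s \<in> borel_measurable borel" "\<And>x. s x \<in> {0..1}" "compact C" "C \<noteq> {}"
    "\<And>x. x \<in> K \<Longrightarrow> s x \<in> C" "continuous_on C \<phi>" "\<phi> ` C \<subseteq> K" "\<And>x. x \<in> K \<Longrightarrow> \<phi> (s x) = x"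
proof -
  obtain D :: "'a set" where D: "countable D" "\<And>X. open X \<Longrightarrow> X \<noteq> {} \<Longrightarrow> \<exists>d\<in>D. d \<in> X"
    using countable_dense_setE by blast
  then have "D \<noteq> {}"
    using D(2)[of UNIV] by auto
  define c where "c = from_nat_into D"
  \<comment> \<open>Index \<open>j\<close> encodes a pair: the number of a centre in the dense set
    and the number of a radius.\<close>
  define A where "A j = ball (c (fst (prod_decode j))) (1 / real (Suc (snd (prod_decode j))))" for j
  define s where "s x = ternary_code (\<lambda>j. x \<in> A j)" for x
  have sm: "s \<in> borel_measurable borel"
  proof -
    have [measurable]: "A j \<in> sets borel" for j by (simp add: A_def)
    show ?thesis unfolding s_def ternary_code_def by measurable
  qed
  have sep: "\<exists>\<delta>>0. \<forall>x\<in>K. \<forall>y\<in>K. \<bar>s x - s y\<bar> < \<delta> \<longrightarrow> dist x y < e" if "e > 0" for e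
  proof -
    obtain n where n: "1 / real (Suc n) < e / 2"
      using \<open>e > 0\<close> nat_approx_posE[of "e/2"] by auto
    have cov: "K \<subseteq> (\<Union>m. ball (c m) (1 / real (Suc n)))"
    proof
      fix x
      obtain d where "d \<in> D" "d \<in> ball x (1 / real (Suc n))"
        using D(2)[of "ball x (1 / real (Suc n))"] by auto
      moreover obtain m where "c m = d"
        using from_nat_into_surj[OF D(1) \<open>d \<in> D\<close>] by (auto simp: c_def)
      ultimately show "x \<in> (\<Union>m. ball (c m) (1 / real (Suc n)))"
        by (auto simp: dist_commute)
    qed
    obtain F where F: "finite F" "K \<subseteq> (\<Union>m\<in>F. ball (c m) (1 / real (Suc n)))"
      using compactE_image[OF \<open>compact K\<close>, of UNIV "\<lambda>m. ball (c m) (1 / real (Suc n))"] cov by auto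
    \<comment> \<open>\<open>N\<close> bounds the indices of the finite subcover by balls of radius
      1/(n+1). Two points whose codes agree up to digit \<open>N\<close> therefore lie in a common
      ball of this subcover.\<close>
    define N where "N = Max ((\<lambda>m. prod_encode (m, n)) ` F)"
    show ?thesis
    proof (intro exI[of _ "1 / 3 ^ Suc N"] conjI ballI impI)
      fix x y assume xy: "x \<in> K" "y \<in> K" "\<bar>s x - s y\<bar> < 1 / 3 ^ Suc N"
      obtain m where m: "m \<in> F" "x \<in> ball (c m) (1 / real (Suc n))"
        using F(2) xy(1) by auto
      define j where "j = prod_encode (m, n)"
      have "j \<le> N"
        unfolding j_def N_def using F(1) m(1) by (intro Max_ge) auto
      have "(x \<in> A j) = (y \<in> A j)"
        using ternary_code_agree[OF xy(3)[unfolded s_def] \<open>j \<le> N\<close>] .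
      moreover have "x \<in> A j"
        using m(2) by (simp add: A_def j_def)
      ultimately have "dist (c m) y < 1 / real (Suc n)" "dist (c m) x < 1 / real (Suc n)"
        by (auto simp: A_def j_def)
      then show "dist x y < e"
        using n dist_triangle3[of x y "c m"] by linarith
    qed simp
  qed
  have inj: "inj_on s K"
  proof (rule inj_onI, rule ccontr)
    fix x y assume "x \<in> K" "y \<in> K" "s x = s y" "x \<noteq> y"
    then show False using sep[of "dist x y"] by fastforce
  qed
  have uc: "uniformly_continuous_on (s ` K) (inv_into K s)"
    unfolding uniformly_continuous_on_def
  proof (intro allI impI)
    fix e :: real assume "e > 0"
    from sep[OF this] obtain \<delta> where "\<delta> > 0"
      "\<And>x y. x \<in> K \<Longrightarrow> y \<in> K \<Longrightarrow> \<bar>s x - s y\<bar> < \<delta> \<Longrightarrow> dist x y < e" by blast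
    then show "\<exists>d>0. \<forall>x\<in>s ` K. \<forall>x'\<in>s ` K. dist x' x < d \<longrightarrow>
        dist (inv_into K s x') (inv_into K s x) < e"
      by (intro exI[of _ \<delta>]) (auto simp: inv_into_f_f[OF inj] dist_real_def)
  qed
  obtain \<phi> where \<phi>: "uniformly_continuous_on (closure (s ` K)) \<phi>"
    "\<And>t. t \<in> s ` K \<Longrightarrow> inv_into K s t = \<phi> t"
    using uniformly_continuous_on_extension_on_closure[OF uc] by metis
  define C where "C = closure (s ` K)"
  have s01: "s x \<in> {0..1}" for x
    using ternary_code_bounds by (simp add: s_def)
  have \<phi>s: "\<phi> (s x) = x" if "x \<in> K" for x
    using \<phi>(2)[of "s x"] that by (simp add: inv_into_f_f[OF inj])
  have "bounded (s ` K)"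
    by (rule bounded_subset[of "{0..1::real}"]) (use s01 in auto)
  then have C: "compact C"
    by (simp add: C_def)
  have cont: "continuous_on C \<phi>"
    unfolding C_def by (rule uniformly_continuous_imp_continuous[OF \<phi>(1)])
  have "\<phi> ` C \<subseteq> K"
    unfolding C_def
    by (rule image_closure_subset)
      (use cont \<phi>s compact_imp_closed[OF \<open>compact K\<close>] in \<open>auto simp: C_def\<close>)
  moreover have "\<And>x. x \<in> K \<Longrightarrow> s x \<in> C" "C \<noteq> {}"
    using \<open>K \<noteq> {}\<close> closure_subset[of "s ` K"] by (auto simp: C_def)
  ultimately show ?thesis
    using that[of s C \<phi>] sm s01 C cont \<phi>s by blast
qed

text \<open>The test functions need not be bounded, since the measures in question live on a common
  compact set.\<close>

definition converges_weakly :: "(nat \<Rightarrow> 'a::topological_space measure) \<Rightarrow> 'a measure \<Rightarrow> bool" where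
  "converges_weakly \<rho> \<nu> \<longleftrightarrow>
     (\<forall>h :: 'a \<Rightarrow> real. continuous_on UNIV h \<longrightarrow> (\<lambda>n. \<integral>x. h x \<partial>\<rho> n) \<longlonglongrightarrow> (\<integral>x. h x \<partial>\<nu>))"

lemma converges_weaklyD:
  fixes h :: "'a::topological_space \<Rightarrow> real"
  assumes "converges_weakly \<rho> \<nu>" "continuous_on UNIV h"
  shows "(\<lambda>n. \<integral>x. h x \<partial>\<rho> n) \<longlonglongrightarrow> (\<integral>x. h x \<partial>\<nu>)"
  using assms by (simp add: converges_weakly_def)

lemma converges_weakly_subseq:
  assumes "converges_weakly \<rho> \<nu>" "strict_mono r"
  shows "converges_weakly (\<lambda>n. \<rho> (r n)) \<nu>"
  unfolding converges_weakly_def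
proof (intro allI impI)
  fix h :: "'a \<Rightarrow> real" assume "continuous_on UNIV h"
  from LIMSEQ_subseq_LIMSEQ[OF converges_weaklyD[OF assms(1) this] assms(2)]
  show "(\<lambda>n. \<integral>x. h x \<partial>\<rho> (r n)) \<longlonglongrightarrow> (\<integral>x. h x \<partial>\<nu>)"
    by (simp add: o_def)
qed

lemma converges_weakly_mass:
  assumes "converges_weakly \<rho> \<nu>"
    and "\<And>n. sets (\<rho> n) = sets borel" "sets \<nu> = sets borel"
  shows "(\<lambda>n. measure (\<rho> n) UNIV) \<longlonglongrightarrow> measure \<nu> UNIV"
  using converges_weaklyD[OF assms(1), of "\<lambda>_. 1"] assms(2,3)[THEN sets_eq_imp_space_eq] by simp

text \<open>The codes lie in [0,1], so the image measures on the line are tight and a subsequence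
  has a weak limit \<open>\<sigma>\<close>. Pushing \<open>\<sigma>\<close> back to \<open>K\<close>
  makes sense because the limit is still concentrated on the closed set \<open>C\<close>, where the
  decoding map is defined and continuous.\<close>

lemma prob_compact_subsequence:
  fixes \<rho> :: "nat \<Rightarrow> 'a::{complete_space, second_countable_topology} measure"
  assumes K: "compact K"
    and s\<rho>: "\<And>n. sets (\<rho> n) = sets borel" and p\<rho>: "\<And>n. prob_space (\<rho> n)"
    and K\<rho>: "\<And>n. AE x in \<rho> n. x \<in> K"
  obtains r \<nu> where "strict_mono (r :: nat \<Rightarrow> nat)" "sets \<nu> = sets borel" "prob_space \<nu>"
    "AE x in \<nu>. x \<in> K"
    "converges_weakly (\<lambda>n. \<rho> (r n)) \<nu>"
proof -
  have "K \<noteq> {}"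
  proof
    assume "K = {}"
    then show False
      using K\<rho>[of 0] prob_space.AE_False[OF p\<rho>[of 0]] by simp
  qed
  obtain s :: "'a \<Rightarrow> real" and C \<phi> where
    s[measurable]: "s \<in> borel_measurable borel" and s01: "\<And>x. s x \<in> {0..1}"
    and C: "compact C" "C \<noteq> {}" and sC: "\<And>x. x \<in> K \<Longrightarrow> s x \<in> C"
    and \<phi>: "continuous_on C \<phi>" "\<phi> ` C \<subseteq> K" and \<phi>s: "\<And>x. x \<in> K \<Longrightarrow> \<phi> (s x) = x"
    using compact_borel_code[OF K \<open>K \<noteq> {}\<close>] by blast
  have [measurable]: "C \<in> sets borel" "K \<in> sets borel"
    using C(1) K by (auto intro: borel_compact)
  define \<theta> where "\<theta> n = distr (\<rho> n) borel s" for n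
  have s'[measurable]: "s \<in> measurable (\<rho> n) borel" for n
    using s by (simp add: measurable_cong_sets[OF s\<rho> refl])
  have \<theta>: "real_distribution (\<theta> n)" for n
    unfolding real_distribution_def real_distribution_axioms_def \<theta>_def
    using prob_space.prob_space_distr[OF p\<rho> s'] by simp
  have "tight \<theta>"
    unfolding tight_def
  proof (intro conjI allI impI \<theta>)
    fix \<epsilon> :: real assume "\<epsilon> > 0"
    \<comment> \<open>Tightness is phrased with left-open intervals; the left endpoint lies below 0
      so that the code 0 is included.\<close>
    have "measure (\<theta> n) {-1<..1} = 1" for n
    proof -
      have "s -` {-1<..1} \<inter> space (\<rho> n) = space (\<rho> n)"
        using s01 by (force intro: less_le_trans[of "-1" 0])
      then show ?thesis
        by (simp add: \<theta>_def measure_distr prob_space.prob_space[OF p\<rho>])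
    qed
    with \<open>\<epsilon> > 0\<close> show "\<exists>a b. a < b \<and> (\<forall>n. 1 - \<epsilon> < measure (\<theta> n) {a<..b})"
      by (intro exI[of _ "-1"] exI[of _ 1]) simp
  qed
  from tight_imp_convergent_subsubsequence[OF this strict_mono_id]
  obtain r \<sigma> where r: "strict_mono (r :: nat \<Rightarrow> nat)" and \<sigma>: "real_distribution \<sigma>"
    and conv: "weak_conv_m (\<lambda>n. \<theta> (r n)) \<sigma>"
    by (auto simp: o_def)
  interpret \<sigma>: real_distribution \<sigma> by fact
  have lim: "(\<lambda>n. \<integral>t. f t \<partial>\<theta> (r n)) \<longlonglongrightarrow> (\<integral>t. f t \<partial>\<sigma>)"
    if "continuous_on UNIV f" "\<And>t. norm (f t) \<le> B" for f :: "real \<Rightarrow> real" and B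
    using that weak_conv_imp_integral_bdd_continuous_conv[OF \<theta> \<sigma> conv, of f B]
    by (simp add: continuous_on_eq_continuous_at)
  have \<sigma>C: "AE t in \<sigma>. t \<in> C"
  proof -
    \<comment> \<open>A bounded continuous function that vanishes exactly on \<open>C\<close>. Its
      integrals against \<open>\<theta> n\<close> are zero, hence so is the one against
      \<open>\<sigma>\<close>, which forces \<open>\<sigma>\<close> onto \<open>C\<close>.\<close>
    define f where "f t = min 1 (infdist t C)" for t
    have f: "continuous_on UNIV f" "\<And>t. 0 \<le> f t" "\<And>t. f t \<le> 1"
      by (auto simp: f_def infdist_nonneg intro!: continuous_intros)
    have fm[measurable]: "f \<in> borel_measurable borel"
      by (rule borel_measurable_continuous_onI[OF f(1)])
    have "(\<integral>t. f t \<partial>\<theta> n) = 0" for n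
    proof -
      have "(\<integral>t. f t \<partial>\<theta> n) = (\<integral>x. f (s x) \<partial>\<rho> n)"
        unfolding \<theta>_def by (rule integral_distr) auto
      also have "\<dots> = (\<integral>x. 0 \<partial>\<rho> n)"
        using K\<rho>[of n] sC measurable_compose[OF s' fm]
        by (intro integral_cong_AE) (auto simp: f_def elim!: eventually_mono)
      finally show ?thesis by simp
    qed
    then have "(\<integral>t. f t \<partial>\<sigma>) = 0"
      using lim[of f 1] f by (simp add: LIMSEQ_const_iff)
    moreover have "integrable \<sigma> f"
      by (rule \<sigma>.integrable_const_bound[of _ 1]) (use f in auto)
    ultimately have "AE t in \<sigma>. f t = 0"
      using integral_nonneg_eq_0_iff_AE f(2) by blast
    then show ?thesis
      by eventually_elim
        (use C in \<open>auto simp: f_def min_def in_closed_iff_infdist_zero[OF compact_imp_closed] split: if_splits\<close>)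
  qed
  obtain p where p: "p \<in> K"
    using \<open>K \<noteq> {}\<close> by blast
  \<comment> \<open>Decoding made total: off \<open>C\<close>, a \<open>\<sigma>\<close>-null set,
    the value is an arbitrary point of \<open>K\<close>, so that \<open>\<psi>\<close> is Borel and
    never leaves \<open>K\<close>.\<close>
  define \<psi> where "\<psi> t = (if t \<in> C then \<phi> t else p)" for t
  have [measurable]: "\<psi> \<in> borel_measurable borel"
    unfolding \<psi>_def using \<phi>(1) by (intro borel_measurable_continuous_on_if) auto
  have \<psi>K: "\<psi> t \<in> K" for t
    using \<phi>(2) p by (auto simp: \<psi>_def)
  define \<nu> where "\<nu> = distr \<sigma> borel \<psi>"
  show ?thesis
  proof (rule that[OF r, of \<nu>])
    show "sets \<nu> = sets borel" by (simp add: \<nu>_def)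
    show "prob_space \<nu>"
      unfolding \<nu>_def by (rule \<sigma>.prob_space_distr) simp
    show "AE x in \<nu>. x \<in> K"
      unfolding \<nu>_def by (subst AE_distr_iff) (auto simp: \<psi>K)
    show "converges_weakly (\<lambda>n. \<rho> (r n)) \<nu>"
      unfolding converges_weakly_def
    proof (intro allI impI)
      fix h :: "'a \<Rightarrow> real" assume h: "continuous_on UNIV h"
      have [measurable]: "h \<in> borel_measurable borel"
        by (rule borel_measurable_continuous_onI[OF h])
      have "continuous_on C (\<lambda>t. h (\<phi> t))"
        by (rule continuous_on_compose2[OF h \<phi>(1)]) simp
      moreover obtain B where "0 \<le> B" "\<And>t. t \<in> C \<Longrightarrow> norm (h (\<phi> t)) \<le> B"
      proof -
        have "bounded ((\<lambda>t. h (\<phi> t)) ` C)"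
          using calculation C(1) by (intro compact_imp_bounded compact_continuous_image)
        then show ?thesis
          using that unfolding bounded_pos by (metis imageI less_imp_le)
      qed
      \<comment> \<open>Tietze extends the decoded test function from \<open>C\<close> to a bounded
        continuous function on the line. Since \<open>\<phi>\<close> inverts \<open>s\<close> on
        \<open>K\<close>, composing \<open>f\<close> with \<open>s\<close> gives back
        \<open>h\<close> on \<open>K\<close>, although \<open>s\<close> need not be
        continuous.\<close>
      ultimately obtain f where f: "continuous_on UNIV f" "\<And>t. t \<in> C \<Longrightarrow> f t = h (\<phi> t)"
        "\<And>t. norm (f t) \<le> B"
        using Tietze[of C "\<lambda>t. h (\<phi> t)" UNIV B] compact_imp_closed[OF C(1)]
        by (metis UNIV_I closed_closedin subtopology_UNIV)
      have [measurable]: "f \<in> borel_measurable borel"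
        by (rule borel_measurable_continuous_onI[OF f(1)])
      have "(\<integral>x. h x \<partial>\<rho> n) = (\<integral>t. f t \<partial>\<theta> n)" for n
      proof -
        have "(\<integral>t. f t \<partial>\<theta> n) = (\<integral>x. f (s x) \<partial>\<rho> n)"
          unfolding \<theta>_def by (rule integral_distr) auto
        also have "\<dots> = (\<integral>x. h x \<partial>\<rho> n)"
        proof (rule integral_cong_AE)
          show "h \<in> borel_measurable (\<rho> n)"
            by (simp add: measurable_cong_sets[OF s\<rho> refl])
          show "AE x in \<rho> n. f (s x) = h x"
            using K\<rho>[of n] by eventually_elim (simp add: f(2) sC \<phi>s)
        qed simp
        finally show ?thesis by simp
      qed
      moreover have "(\<integral>x. h x \<partial>\<nu>) = (\<integral>t. f t \<partial>\<sigma>)"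
      proof -
        have "(\<integral>x. h x \<partial>\<nu>) = (\<integral>t. h (\<psi> t) \<partial>\<sigma>)"
          unfolding \<nu>_def by (rule integral_distr) auto
        also have "\<dots> = (\<integral>t. f t \<partial>\<sigma>)"
        proof (rule integral_cong_AE)
          show "AE t in \<sigma>. h (\<psi> t) = f t"
            using \<sigma>C by eventually_elim (simp add: f(2) \<psi>_def)
        qed simp_all
        finally show ?thesis .
      qed
      ultimately show "(\<lambda>n. \<integral>x. h x \<partial>\<rho> (r n)) \<longlonglongrightarrow> (\<integral>x. h x \<partial>\<nu>)"
        using lim[OF f(1,3)] by simp
    qed
  qed
qed

section \<open>From probability measures to finite measures and finite families\<close>

lemma borel_measuresI: "sets \<mu> = sets borel \<Longrightarrow> finite_measure \<mu> \<Longrightarrow> \<mu> \<in> borel_measures"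
  by (simp add: borel_measures_def)

text \<open>Each measure is split into its mass and its normalisation. The masses lie in a bounded
  interval, so Bolzano-Weierstrass yields a convergent subsequence of them; the limit of the
  normalised measures is then rescaled by the limit mass, which may be zero.\<close>

lemma finite_compact_subsequence:
  fixes \<rho> :: "nat \<Rightarrow> 'a::{complete_space, second_countable_topology} measure"
  assumes K: "compact K" and \<rho>: "\<And>n. \<rho> n \<in> borel_measures"
    and K\<rho>: "\<And>n. AE x in \<rho> n. x \<in> K" and M: "\<And>n. measure (\<rho> n) UNIV \<le> M"
  obtains r \<nu> where "strict_mono (r :: nat \<Rightarrow> nat)" "\<nu> \<in> borel_measures"
    "AE x in \<nu>. x \<in> K" "converges_weakly (\<lambda>n. \<rho> (r n)) \<nu>"
proof -
  note B = borel_measuresD[OF \<rho>]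
  define m where "m n = measure (\<rho> n) UNIV" for n
  have em: "emeasure (\<rho> n) UNIV = ennreal (m n)" for n
    unfolding m_def by (rule finite_measure.emeasure_eq_measure[OF B(3)])
  have hm: "h \<in> borel_measurable (\<rho> n)" if "continuous_on UNIV h" for h :: "'a \<Rightarrow> real" and n
    using borel_measurable_continuous_onI[OF that] by (simp add: measurable_cong_sets[OF B(1) refl])
  have zero: "(\<integral>x. h x \<partial>\<rho> n) = 0" if "m n = 0" for h :: "'a \<Rightarrow> real" and n
  proof (rule integral_eq_zero_AE)
    show "AE x in \<rho> n. h x = 0"
      by (rule AE_I[of _ _ UNIV]) (use em[of n] that B in auto)
  qed
  show ?thesis
  proof (cases "K = {}")
    case True
    have "m n = 0" for n
    proof -
      have "emeasure (\<rho> n) (space (\<rho> n)) = 0"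
        using K\<rho>[of n] True AE_iff_measurable[of "space (\<rho> n)" "\<rho> n" "\<lambda>_. False"] by auto
      then show ?thesis
        by (simp add: m_def measure_def B(2))
    qed
    moreover have "(\<integral>x. h x \<partial>null_measure borel) = 0" for h :: "'a \<Rightarrow> real"
      by (rule integral_eq_zero_AE, rule AE_I[of _ _ UNIV]) auto
    ultimately have "converges_weakly \<rho> (null_measure borel)"
      by (simp add: converges_weakly_def zero)
    moreover have "AE x in null_measure borel. x \<in> K"
      by (rule AE_I[of _ _ UNIV]) auto
    moreover have "null_measure borel \<in> borel_measures"
      by (auto simp: borel_measures_def intro: finite_measureI)
    ultimately show ?thesis
      using that[of id "null_measure borel"] strict_mono_id by simp
  next
    case False
    then obtain p where p: "p \<in> K" by blast
    \<comment> \<open>A measure of mass zero cannot be normalised and is replaced by a point mass in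
      \<open>K\<close>. The choice is irrelevant, since its integrals are multiplied by
      \<open>m n\<close> = 0 afterwards. An empty \<open>K\<close> offers no such point, which is
      why it is treated separately.\<close>
    define q where "q n = (if m n = 0 then return borel p
      else density (\<rho> n) (\<lambda>_. ennreal (1 / m n)))" for n
    have mn: "m n \<ge> 0" for n by (simp add: m_def)
    have qs: "sets (q n) = sets borel" for n
      by (simp add: q_def B)
    have "emeasure (q n) (space (q n)) = 1" for n
    proof (cases "m n = 0")
      case False
      then have "ennreal (1 / m n) * ennreal (m n) = 1"
        using mn[of n] by (simp flip: ennreal_mult)
      with False show ?thesis
        by (simp add: q_def B emeasure_density_const em)
    qed (simp add: q_def)
    then have qp: "prob_space (q n)" for n
      by (rule prob_spaceI)
    have [measurable]: "K \<in> sets borel"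
      using K by (rule borel_compact)
    have qK: "AE x in q n. x \<in> K" for n
    proof (cases "m n = 0")
      case True
      have "AE x in return borel p. x \<in> K"
        by (subst AE_return) (use p in auto)
      with True show ?thesis unfolding q_def by simp
    next
      case False
      have "AE x in density (\<rho> n) (\<lambda>_. ennreal (1 / m n)). x \<in> K"
        using K\<rho>[of n] by (subst AE_density) auto
      with False show ?thesis unfolding q_def by simp
    qed
    have qi: "(\<integral>x. h x \<partial>\<rho> n) = m n * (\<integral>x. h x \<partial>q n)" if "continuous_on UNIV h" for h n
    proof (cases "m n = 0")
      case False
      then have "(\<integral>x. h x \<partial>q n) = (\<integral>x. (1 / m n) *\<^sub>R h x \<partial>\<rho> n)"
        unfolding q_def if_not_P[OF False]
        by (intro integral_density hm that) (use mn in auto)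
      with False show ?thesis by simp
    qed (simp add: zero)
    obtain r1 \<nu>1 where 1: "strict_mono (r1 :: nat \<Rightarrow> nat)" "sets \<nu>1 = sets borel" "prob_space \<nu>1"
      "AE x in \<nu>1. x \<in> K"
      "converges_weakly (\<lambda>n. q (r1 n)) \<nu>1"
      using prob_compact_subsequence[of K q, OF K qs qp qK] by blast
    have "bounded (range (\<lambda>n. m (r1 n)))"
      by (rule bounded_subset[of "{0..M}"]) (use mn M in \<open>auto simp: m_def\<close>)
    from bounded_imp_convergent_subsequence[OF this]
    obtain c r2 where 2: "strict_mono (r2 :: nat \<Rightarrow> nat)" "(\<lambda>n. m (r1 (r2 n))) \<longlonglongrightarrow> c"
      unfolding o_def by metis
    have c: "c \<ge> 0"
      by (rule LIMSEQ_le_const[OF 2(2)]) (use mn in blast)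
    define \<nu> where "\<nu> = density \<nu>1 (\<lambda>_. ennreal c)"
    have "emeasure \<nu> (space \<nu>) = ennreal c"
      using prob_space.emeasure_space_1[OF 1(3)] by (simp add: \<nu>_def emeasure_density_const)
    then have "\<nu> \<in> borel_measures"
      using 1(2) by (intro borel_measuresI finite_measureI) (simp_all add: \<nu>_def)
    moreover have "AE x in \<nu>. x \<in> K"
      unfolding \<nu>_def using 1(4) by (subst AE_density) auto
    moreover have "converges_weakly (\<lambda>n. \<rho> (r1 (r2 n))) \<nu>"
      unfolding converges_weakly_def
    proof (intro allI impI)
      fix h :: "'a \<Rightarrow> real" assume h: "continuous_on UNIV h"
      have "h \<in> borel_measurable \<nu>1"
        using borel_measurable_continuous_onI[OF h] by (simp add: measurable_cong_sets[OF 1(2) refl])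
      then have "(\<integral>x. h x \<partial>\<nu>) = (\<integral>x. c *\<^sub>R h x \<partial>\<nu>1)"
        unfolding \<nu>_def by (intro integral_density) (use c in auto)
      then have eq: "(\<integral>x. h x \<partial>\<nu>) = c * (\<integral>x. h x \<partial>\<nu>1)"
        by simp
      have "(\<lambda>n. \<integral>x. h x \<partial>q (r1 (r2 n))) \<longlonglongrightarrow> (\<integral>x. h x \<partial>\<nu>1)"
        using converges_weakly_subseq[OF 1(5) 2(1)] h by (rule converges_weaklyD)
      from tendsto_mult[OF 2(2) this]
      show "(\<lambda>n. \<integral>x. h x \<partial>\<rho> (r1 (r2 n))) \<longlonglongrightarrow> (\<integral>x. h x \<partial>\<nu>)"
        by (simp add: eq qi[OF h])
    qed
    moreover have "strict_mono (\<lambda>n. r1 (r2 n))"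
      using 1(1) 2(1) by (simp add: strict_mono_def)
    ultimately show ?thesis
      by (intro that[of "\<lambda>n. r1 (r2 n)" \<nu>])
  qed
qed

text \<open>Extraction one index at a time: the limits already found survive every further thinning,
  so finitely many rounds give one common subsequence.\<close>

lemma finite_family_compact_subsequence:
  fixes \<gamma> :: "'i \<Rightarrow> nat \<Rightarrow> 'a::{complete_space, second_countable_topology} measure"
  assumes "finite I" and K: "compact K" and "\<And>i n. i \<in> I \<Longrightarrow> \<gamma> i n \<in> borel_measures"
    and "\<And>i n. i \<in> I \<Longrightarrow> AE x in \<gamma> i n. x \<in> K"
    and "\<And>i n. i \<in> I \<Longrightarrow> measure (\<gamma> i n) UNIV \<le> M i"
  shows "\<exists>r \<nu>. strict_mono (r :: nat \<Rightarrow> nat) \<and> (\<forall>i\<in>I. \<nu> i \<in> borel_measures \<and>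
    (AE x in \<nu> i. x \<in> K) \<and> converges_weakly (\<lambda>n. \<gamma> i (r n)) (\<nu> i))"
  using assms(1,3-)
proof (induction I)
  case empty
  then show ?case using strict_mono_id by blast
next
  case (insert j I)
  have "\<exists>r \<nu>. strict_mono (r :: nat \<Rightarrow> nat) \<and> (\<forall>i\<in>I. \<nu> i \<in> borel_measures \<and>
      (AE x in \<nu> i. x \<in> K) \<and> converges_weakly (\<lambda>n. \<gamma> i (r n)) (\<nu> i))"
    by (rule insert.IH; rule insert.prems; simp)
  then obtain r \<nu> where r: "strict_mono (r :: nat \<Rightarrow> nat)"
    and \<nu>: "\<And>i. i \<in> I \<Longrightarrow> \<nu> i \<in> borel_measures" "\<And>i. i \<in> I \<Longrightarrow> AE x in \<nu> i. x \<in> K"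
      "\<And>i. i \<in> I \<Longrightarrow> converges_weakly (\<lambda>n. \<gamma> i (r n)) (\<nu> i)"
    by auto
  obtain r' \<nu>' where r': "strict_mono (r' :: nat \<Rightarrow> nat)" "\<nu>' \<in> borel_measures"
    "AE x in \<nu>'. x \<in> K" "converges_weakly (\<lambda>n. \<gamma> j (r (r' n))) \<nu>'"
    using finite_compact_subsequence[OF K, of "\<lambda>n. \<gamma> j (r n)" "M j"] insert.prems[OF insertI1] by blast
  have "strict_mono (\<lambda>n. r (r' n))"
    using r r'(1) by (simp add: strict_mono_def)
  moreover have "\<exists>\<nu>'. \<forall>i\<in>insert j I. \<nu>' i \<in> borel_measures \<and> (AE x in \<nu>' i. x \<in> K) \<and>
      converges_weakly (\<lambda>n. \<gamma> i (r (r' n))) (\<nu>' i)"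
  proof (intro exI[of _ "\<nu>(j := \<nu>')"] ballI)
    fix i assume "i \<in> insert j I"
    then consider "(\<nu>(j := \<nu>')) i = \<nu>'" "i = j" | "(\<nu>(j := \<nu>')) i = \<nu> i" "i \<in> I"
      using insert.hyps(2) by (cases "i = j") auto
    then show "(\<nu>(j := \<nu>')) i \<in> borel_measures \<and> (AE x in (\<nu>(j := \<nu>')) i. x \<in> K) \<and>
        converges_weakly (\<lambda>n. \<gamma> i (r (r' n))) ((\<nu>(j := \<nu>')) i)"
    proof cases
      case 1
      with r' show ?thesis unfolding 1(1) by simp
    next
      case 2
      with \<nu> converges_weakly_subseq[OF \<nu>(3) r'(1)] show ?thesis unfolding 2(1) by simp
    qed
  qed
  ultimately show ?case by blast
qed

text \<open>The way back from test functions to sets. The indicator of a closed set is a pointwise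
  limit of continuous functions with values in [0,1], which settles closed sets; inner regularity by
  compact sets on a Polish space then reaches all Borel sets.\<close>

lemma emeasure_le_from_integrals:
  fixes \<alpha> \<beta> :: "'a::polish_space measure"
  assumes \<alpha>: "\<alpha> \<in> borel_measures" and \<beta>: "\<beta> \<in> borel_measures"
    and le: "\<And>h :: 'a \<Rightarrow> real. continuous_on UNIV h \<Longrightarrow> (\<And>x. 0 \<le> h x) \<Longrightarrow> (\<And>x. h x \<le> 1) \<Longrightarrow>
      (\<integral>x. h x \<partial>\<alpha>) \<le> (\<integral>x. h x \<partial>\<beta>)"
    and A: "A \<in> sets borel"
  shows "emeasure \<alpha> A \<le> emeasure \<beta> A"
proof -
  have closed: "measure \<alpha> F \<le> measure \<beta> F" if F: "closed F" "F \<noteq> {}" for F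
  proof -
    \<comment> \<open>A tent of slope \<open>n\<close> around \<open>F\<close>. For empty
      \<open>F\<close> the value of \<open>infdist\<close> is 0 by convention and the tent would be
      constantly 1, hence the restriction to nonempty \<open>F\<close>.\<close>
    define h where "h n x = max 0 (1 - real n * infdist x F)" for n x
    have h: "continuous_on UNIV (h n)" "0 \<le> h n x" "h n x \<le> 1" for n x
      by (auto simp: h_def infdist_nonneg intro!: continuous_intros)
    have hlim: "(\<lambda>n. h n x) \<longlonglongrightarrow> indicator F x" for x
    proof (cases "x \<in> F")
      case True
      then show ?thesis by (simp add: h_def)
    next
      case False
      then have "infdist x F > 0"
        using F in_closed_iff_infdist_zero[OF F, of x] infdist_nonneg[of x F] by auto
      then obtain N where N: "1 < real N * infdist x F"
        using ex_less_of_nat_mult by blast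
      have "h n x = 0" if "n \<ge> N" for n
      proof -
        have "real N * infdist x F \<le> real n * infdist x F"
          using that \<open>infdist x F > 0\<close> by (intro mult_right_mono) auto
        with N show ?thesis by (simp add: h_def)
      qed
      with False show ?thesis
        by (auto intro!: tendsto_eventually eventually_sequentiallyI[of N])
    qed
    have lim: "(\<lambda>n. \<integral>x. h n x \<partial>\<eta>) \<longlonglongrightarrow> measure \<eta> F" if \<eta>: "\<eta> \<in> borel_measures" for \<eta>
    proof -
      interpret finite_measure \<eta>
        using \<eta> by (rule borel_measuresD)
      have [measurable_cong]: "sets \<eta> = sets borel"
        using \<eta> by (rule borel_measuresD)
      have [measurable]: "h n \<in> borel_measurable borel" "F \<in> sets borel" for n
        using borel_measurable_continuous_onI[OF h(1)] F by auto
      have "(\<lambda>n. \<integral>x. h n x \<partial>\<eta>) \<longlonglongrightarrow> (\<integral>x. indicator F x \<partial>\<eta>)"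
        by (rule integral_dominated_convergence[where w="\<lambda>_. 1"]) (use h hlim in auto)
      then show ?thesis
        using borel_measuresD(2)[OF \<eta>] by simp
    qed
    show ?thesis
      by (rule LIMSEQ_le[OF lim[OF \<alpha>] lim[OF \<beta>]]) (use le h in auto)
  qed
  note B = borel_measuresD[OF \<alpha>] borel_measuresD[OF \<beta>]
  have "emeasure \<alpha> A = (SUP F\<in>{F. F \<subseteq> A \<and> compact F}. emeasure \<alpha> F)"
    by (rule inner_regular) (use B A in \<open>auto simp: finite_measure.emeasure_finite\<close>)
  also have "\<dots> \<le> emeasure \<beta> A"
  proof (rule SUP_least)
    fix F assume F: "F \<in> {F. F \<subseteq> A \<and> compact F}"
    have "measure \<alpha> F \<le> measure \<beta> F"
      by (cases "F = {}") (use F closed compact_imp_closed in auto)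
    then have "emeasure \<alpha> F \<le> emeasure \<beta> F"
      using B by (simp add: finite_measure.emeasure_eq_measure ennreal_leI)
    also have "\<dots> \<le> emeasure \<beta> A"
      using F A B by (intro emeasure_mono) auto
    finally show "emeasure \<alpha> F \<le> emeasure \<beta> A" .
  qed
  finally show ?thesis .
qed

section \<open>Total variation and transport cost\<close>

lemma measurable_pair_borel:
  "fst \<in> borel_measurable (borel :: ('a::polish_space \<times> 'a) measure)"
  "snd \<in> borel_measurable (borel :: ('a \<times> 'a) measure)"
  by (auto intro!: borel_measurable_continuous_onI continuous_intros)

lemma measurable_dist2:
  "(\<lambda>z. ennreal ((dist (fst z) (snd z))\<^sup>2)) \<in> borel_measurable (borel :: ('a::polish_space \<times> 'a) measure)"
  by (intro measurable_compose[OF _ measurable_ennreal] borel_measurable_continuous_onI continuous_intros)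

lemma borel_measures_null: "null_measure borel \<in> borel_measures"
  by (intro borel_measuresI finite_measureI) auto

lemma borel_measures_distr:
  assumes "\<gamma> \<in> borel_measures" "f \<in> borel_measurable borel"
  shows "distr \<gamma> borel f \<in> borel_measures"
  using assms
  by (intro borel_measuresI finite_measure.finite_measure_distr)
    (auto dest: borel_measuresD simp: measurable_cong_sets[OF borel_measuresD(1) refl])

lemma emeasure_distr_fst:
  fixes \<gamma> :: "('a::polish_space \<times> 'a) measure"
  assumes "\<gamma> \<in> borel_measures" "A \<in> sets borel"
  shows "emeasure (distr \<gamma> borel fst) A = emeasure \<gamma> (A \<times> UNIV)"
proof -
  have "fst \<in> measurable \<gamma> borel"
    using measurable_pair_borel(1) by (simp add: measurable_cong_sets[OF borel_measuresD(1)[OF assms(1)] refl])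
  moreover have "fst -` A \<inter> space \<gamma> = A \<times> UNIV"
    using borel_measuresD(2)[OF assms(1)] by auto
  ultimately show ?thesis
    using assms(2) by (simp add: emeasure_distr)
qed

lemma emeasure_distr_snd:
  fixes \<gamma> :: "('a::polish_space \<times> 'a) measure"
  assumes "\<gamma> \<in> borel_measures" "A \<in> sets borel"
  shows "emeasure (distr \<gamma> borel snd) A = emeasure \<gamma> (UNIV \<times> A)"
proof -
  have "snd \<in> measurable \<gamma> borel"
    using measurable_pair_borel(2) by (simp add: measurable_cong_sets[OF borel_measuresD(1)[OF assms(1)] refl])
  moreover have "snd -` A \<inter> space \<gamma> = UNIV \<times> A"
    using borel_measuresD(2)[OF assms(1)] by auto
  ultimately show ?thesis
    using assms(2) by (simp add: emeasure_distr)
qed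

section \<open>Total variation and the common part of two measures\<close>

lemma total_mass_nonneg:
  assumes "\<mu> \<in> borel_measures" "\<mu>' \<in> borel_measures"
  shows "0 \<le> total_mass (\<lambda>A. measure \<mu> A - measure \<mu>' A)"
  using jordan_decomposition_exists[OF assms] total_mass_eq by fastforce

text \<open>When one measure lies below the other, the negative Jordan part carries no mass. This
  makes the total variation terms linear in the masses.\<close>

lemma total_mass_diff:
  assumes "\<mu> \<in> borel_measures" "\<mu>' \<in> borel_measures"
    and le: "\<And>A. A \<in> sets borel \<Longrightarrow> emeasure \<mu>' A \<le> emeasure \<mu> A"
  shows "total_mass (\<lambda>A. measure \<mu> A - measure \<mu>' A) = measure \<mu> UNIV - measure \<mu>' UNIV"
proof -
  obtain P Q where PQ: "jordan_decomposition (\<lambda>A. measure \<mu> A - measure \<mu>' A) P Q"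
    using jordan_decomposition_exists[OF assms(1,2)] by blast
  then obtain D where D: "D \<in> sets borel" "measure P D = 0" "measure Q (- D) = 0"
    and Q: "Q \<in> borel_measures"
    and eq: "\<And>A. A \<in> sets borel \<Longrightarrow> measure \<mu> A - measure \<mu>' A = measure P A - measure Q A"
    by (auto simp: jordan_decomposition_def)
  have "measure \<mu>' D \<le> measure \<mu> D"
    using le[OF D(1)] assms(1,2)[THEN borel_measuresD(3)]
    by (simp add: finite_measure.emeasure_eq_measure)
  then have "measure Q D = 0"
    using eq[OF D(1)] D(2) measure_nonneg[of Q D] by linarith
  moreover have "measure Q UNIV = measure Q D + measure Q (- D)"
    using finite_measure.finite_measure_Union[OF borel_measuresD(3)[OF Q], of D "- D"]
      D(1) by (simp add: borel_measuresD[OF Q] borel_comp)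
  ultimately have "measure Q UNIV = 0"
    using D(3) by simp
  with total_mass_eq[OF PQ] eq[of UNIV] show ?thesis by simp
qed

text \<open>The density \<open>f\<close> describes \<open>\<mu> \<and> \<mu>'\<close> with respect to \<open>\<mu>'\<close>.\<close>

lemma common_part_density:
  fixes \<mu> \<mu>' :: "'a::metric_space measure"
  assumes \<mu>: "\<mu> \<in> borel_measures" and \<mu>': "\<mu>' \<in> borel_measures"
  obtains f :: "'a \<Rightarrow> real" where "f \<in> borel_measurable borel" "\<And>x. 0 \<le> f x" "\<And>x. f x \<le> 1"
    "\<And>A. A \<in> sets borel \<Longrightarrow> (\<integral>\<^sup>+ x. ennreal (f x) * indicator A x \<partial>\<mu>') \<le> emeasure \<mu> A"
    "measure \<mu> UNIV + measure \<mu>' UNIV - 2 * (\<integral>x. f x \<partial>\<mu>') \<le>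
      total_mass (\<lambda>A. measure \<mu> A - measure \<mu>' A)"
proof -
  obtain P Q where PQ: "jordan_decomposition (\<lambda>A. measure \<mu> A - measure \<mu>' A) P Q"
    using jordan_decomposition_exists[OF \<mu> \<mu>'] by blast
  then obtain D where D: "D \<in> sets borel" "measure P D = 0" "measure Q (- D) = 0"
    and P: "P \<in> borel_measures" and Q: "Q \<in> borel_measures"
    and eq: "\<And>A. A \<in> sets borel \<Longrightarrow> measure \<mu> A - measure \<mu>' A = measure P A - measure Q A"
    by (auto simp: jordan_decomposition_def)
  note B = borel_measuresD[OF \<mu>] and B' = borel_measuresD[OF \<mu>'] and BP = borel_measuresD[OF P]
    and BQ = borel_measuresD[OF Q]
  interpret \<mu>: finite_measure \<mu> by (fact B)
  interpret \<mu>': finite_measure \<mu>' by (fact B')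
  interpret P: finite_measure P by (fact BP)
  interpret Q: finite_measure Q by (fact BQ)
  have [measurable]: "D \<in> sets borel" by (fact D)
  \<comment> \<open>\<open>Q\<close> lives on \<open>D\<close>, and \<open>P\<close> vanishes there,
    so on subsets of \<open>D\<close> it equals \<open>\<mu>'\<close> minus \<open>\<mu>\<close>.
    Domination by \<open>\<mu>'\<close> gives the absolute continuity needed for a density.\<close>
  have Qle: "measure Q A \<le> measure \<mu>' A" if [measurable]: "A \<in> sets borel" for A
  proof -
    have "measure Q A \<le> measure Q (A \<inter> D \<union> - D)"
      by (rule Q.finite_measure_mono) (auto simp: BQ)
    also have "\<dots> \<le> measure Q (A \<inter> D) + measure Q (- D)"
      by (rule measure_Un_le) (auto simp: BQ)
    finally have "measure Q A \<le> measure Q (A \<inter> D)" using D by simp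
    moreover have "measure P (A \<inter> D) \<le> measure P D"
      by (rule P.finite_measure_mono) (auto simp: BP)
    moreover have "measure \<mu>' (A \<inter> D) \<le> measure \<mu>' A"
      by (rule \<mu>'.finite_measure_mono) (auto simp: B')
    moreover have "measure \<mu> (A \<inter> D) - measure \<mu>' (A \<inter> D) = measure P (A \<inter> D) - measure Q (A \<inter> D)"
      by (rule eq) measurable
    ultimately show ?thesis
      using D(2) measure_nonneg[of \<mu> "A \<inter> D"] by linarith
  qed
  have "absolutely_continuous \<mu>' Q"
    unfolding absolutely_continuous_def
  proof
    fix N assume N: "N \<in> null_sets \<mu>'"
    then have "N \<in> sets borel" "measure \<mu>' N = 0"
      by (auto simp: null_sets_def B' measure_def)
    with Qle[of N] show "N \<in> null_sets Q"
      by (auto simp: null_sets_def BQ Q.emeasure_eq_measure measure_le_0_iff)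
  qed
  then obtain q where q: "q \<in> borel_measurable \<mu>'" "density \<mu>' q = Q"
    using \<mu>'.Radon_Nikodym[of Q] BQ(1) B'(1) by auto
  have qb[measurable]: "q \<in> borel_measurable borel"
    using q(1) by (simp add: measurable_cong_sets[OF B'(1) refl])
  have mb[measurable_cong]: "sets \<mu>' = sets borel" by (fact B')
  \<comment> \<open>The common part of the two measures is \<open>\<mu>'\<close> minus
    \<open>Q\<close>, so its density is 1 - \<open>q\<close>. The truncation at 1 makes the bounds 0
    and 1 hold at every point rather than almost everywhere.\<close>
  define f where "f x = enn2real (1 - min 1 (q x))" for x
  have ef: "ennreal (f x) = 1 - min 1 (q x)" for x
    unfolding f_def by (rule ennreal_enn2real) (auto simp: less_top[symmetric] ennreal_minus_eq_top)
  have f[measurable]: "f \<in> borel_measurable borel"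
    unfolding f_def by measurable
  have f0: "0 \<le> f x" for x
    by (simp add: f_def)
  have "ennreal (f x) \<le> 1" for x
    unfolding ef by (rule order_trans[OF diff_le_self_ennreal]) simp
  then have f1: "f x \<le> 1" for x
    by (simp add: f0 flip: ennreal_1)
  have bound: "(\<integral>\<^sup>+ x. ennreal (f x) * indicator A x \<partial>\<mu>') \<le> emeasure \<mu> A"
    if [measurable]: "A \<in> sets borel" for A
  proof -
    \<comment> \<open>Where \<open>q\<close> exceeds 1 the density \<open>f\<close> vanishes, so
      only \<open>E\<close> matters, and there \<open>f\<close> + \<open>q\<close> = 1. The integral
      of \<open>f\<close> over \<open>A\<close> is thus \<open>\<mu>'\<close> minus \<open>Q\<close>
      on \<open>E\<close>, which equals \<open>\<mu>\<close> minus \<open>P\<close> there.\<close>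
    define E where "E = A \<inter> {x. q x \<le> 1}"
    have E[measurable]: "E \<in> sets borel"
      unfolding E_def by measurable
    have "ennreal (f x) * indicator A x + q x * indicator E x = indicator E x" for x
    proof (cases "q x \<le> 1")
      case True
      then show ?thesis
        by (auto simp: ef E_def min_absorb2 indicator_def diff_add_cancel_ennreal)
    next
      case False
      then show ?thesis
        by (auto simp: ef E_def min_absorb1 indicator_def)
    qed
    then have "emeasure \<mu>' E = (\<integral>\<^sup>+ x. ennreal (f x) * indicator A x + q x * indicator E x \<partial>\<mu>')"
      by (simp add: B')
    also have "\<dots> = (\<integral>\<^sup>+ x. ennreal (f x) * indicator A x \<partial>\<mu>') + (\<integral>\<^sup>+ x. q x * indicator E x \<partial>\<mu>')"
      by (intro nn_integral_add) auto
    also have "(\<integral>\<^sup>+ x. q x * indicator E x \<partial>\<mu>') = emeasure Q E"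
      using q E by (simp add: emeasure_density[symmetric] B')
    finally have "(\<integral>\<^sup>+ x. ennreal (f x) * indicator A x \<partial>\<mu>') = emeasure \<mu>' E - emeasure Q E"
      by (simp add: Q.emeasure_finite)
    also have "\<dots> = ennreal (measure \<mu>' E - measure Q E)"
      by (simp add: \<mu>'.emeasure_eq_measure Q.emeasure_eq_measure ennreal_minus)
    also have "\<dots> \<le> ennreal (measure \<mu> E)"
      using eq[OF E] measure_nonneg[of P E] by (intro ennreal_leI) linarith
    also have "\<dots> \<le> emeasure \<mu> A"
      unfolding \<mu>.emeasure_eq_measure[symmetric]
      by (rule emeasure_mono) (auto simp: E_def B)
    finally show ?thesis .
  qed
  have int: "integrable \<mu>' f"
    by (rule \<mu>'.integrable_const_bound[of _ 1]) (auto simp: f0 f1)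
  \<comment> \<open>The masses of \<open>P\<close> and \<open>Q\<close> add up to the mass of
    \<open>\<mu>\<close> minus that of \<open>\<mu>'\<close> plus twice that of \<open>Q\<close>. It
    therefore suffices to bound the mass of \<open>Q\<close> from below by the part of
    \<open>\<mu>'\<close> that \<open>f\<close> leaves out.\<close>
  have "emeasure \<mu>' UNIV = (\<integral>\<^sup>+ x. 1 \<partial>\<mu>')"
    by (simp add: B')
  also have "\<dots> \<le> (\<integral>\<^sup>+ x. ennreal (f x) + q x \<partial>\<mu>')"
  proof (rule nn_integral_mono)
    fix x
    have "1 = (1 - min 1 (q x)) + min 1 (q x)"
      by (rule diff_add_cancel_ennreal[symmetric]) simp
    also have "\<dots> \<le> ennreal (f x) + q x"
      unfolding ef by (intro add_left_mono) simp
    finally show "1 \<le> ennreal (f x) + q x" .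
  qed
  also have "\<dots> = (\<integral>\<^sup>+ x. ennreal (f x) \<partial>\<mu>') + (\<integral>\<^sup>+ x. q x \<partial>\<mu>')"
    by (intro nn_integral_add) auto
  also have "(\<integral>\<^sup>+ x. q x \<partial>\<mu>') = emeasure Q UNIV"
    using q(1) unfolding q(2)[symmetric] by (subst emeasure_density) (auto simp: B')
  also have "(\<integral>\<^sup>+ x. ennreal (f x) \<partial>\<mu>') = ennreal (\<integral>x. f x \<partial>\<mu>')"
    by (rule nn_integral_eq_integral[OF int]) (simp add: f0)
  finally have "measure \<mu>' UNIV \<le> (\<integral>x. f x \<partial>\<mu>') + measure Q UNIV"
    by (simp add: \<mu>'.emeasure_eq_measure Q.emeasure_eq_measure f0 flip: ennreal_plus)
  then have "measure \<mu> UNIV + measure \<mu>' UNIV - 2 * (\<integral>x. f x \<partial>\<mu>') \<le>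
      total_mass (\<lambda>A. measure \<mu> A - measure \<mu>' A)"
    using total_mass_eq[OF PQ] eq[of UNIV] by simp
  then show ?thesis
    using that[of f] f f0 f1 bound by blast
qed

section \<open>The Wasserstein distance through unnormalised plans\<close>

lemma W2_square:
  "(W2 \<mu>1 \<mu>2)\<^sup>2 = measure \<mu>1 UNIV *
    enn2real (INF \<pi>\<in>transport_plans \<mu>1 \<mu>2. \<integral>\<^sup>+ (x, y). ennreal ((dist x y)\<^sup>2) \<partial>\<pi>)"
  unfolding W2_def by (rule real_sqrt_pow2) simp

text \<open>The mass factor in \<open>W2\<close> cancels the normalisation of plans: dividing
  \<open>\<gamma>\<close> by its mass gives an admissible plan, and the factor restores the cost of
  \<open>\<gamma>\<close> itself. At mass zero the factor alone makes \<open>W2\<close>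
  vanish.\<close>

lemma W2_square_le:
  fixes \<gamma> :: "('a::polish_space \<times> 'a) measure"
  assumes \<mu>1: "\<mu>1 \<in> borel_measures" and \<mu>2: "\<mu>2 \<in> borel_measures" and \<gamma>: "\<gamma> \<in> borel_measures"
    and fst: "\<And>A. A \<in> sets borel \<Longrightarrow> emeasure \<gamma> (A \<times> UNIV) = emeasure \<mu>1 A"
    and snd: "\<And>A. A \<in> sets borel \<Longrightarrow> emeasure \<gamma> (UNIV \<times> A) = emeasure \<mu>2 A"
    and c: "(\<integral>\<^sup>+ z. ennreal ((dist (fst z) (snd z))\<^sup>2) \<partial>\<gamma>) \<le> ennreal c" "0 \<le> c"
  shows "(W2 \<mu>1 \<mu>2)\<^sup>2 \<le> c"
proof (cases "measure \<mu>1 UNIV = 0")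
  case True
  with c(2) show ?thesis by (simp add: W2_square)
next
  case False
  define m where "m = measure \<mu>1 UNIV"
  have m: "m > 0"
    using False by (simp add: m_def zero_less_measure_iff)
  have e\<gamma>: "measure \<gamma> (A \<times> UNIV) = measure \<mu>1 A" "measure \<gamma> (UNIV \<times> A) = measure \<mu>2 A"
    if "A \<in> sets borel" for A
    using fst[OF that] snd[OF that] by (simp_all add: measure_def)
  have m2: "measure \<mu>2 UNIV = m"
    using e\<gamma>[of UNIV] by (simp add: m_def)
  define \<pi> where "\<pi> = scale_measure (ennreal (1 / m)) \<gamma>"
  have meas: "measure \<pi> A = measure \<gamma> A / m" for A
    using m by (simp add: \<pi>_def)
  have "emeasure \<pi> (space \<pi>) = 1"
  proof -
    have "emeasure \<gamma> UNIV = ennreal m"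
      using fst[of UNIV] finite_measure.emeasure_eq_measure[OF borel_measuresD(3)[OF \<mu>1]]
      by (simp add: m_def)
    then show ?thesis
      using m by (simp add: \<pi>_def space_scale_measure borel_measuresD(2)[OF \<gamma>] flip: ennreal_mult)
  qed
  then have "prob_space \<pi>" by (rule prob_spaceI)
  then have "\<pi> \<in> transport_plans \<mu>1 \<mu>2"
    using m by (auto simp: transport_plans_def meas e\<gamma> m2 \<pi>_def borel_measuresD(1)[OF \<gamma>] simp flip: m_def)
  then have "(INF \<pi>\<in>transport_plans \<mu>1 \<mu>2. \<integral>\<^sup>+ (x, y). ennreal ((dist x y)\<^sup>2) \<partial>\<pi>) \<le>
      (\<integral>\<^sup>+ (x, y). ennreal ((dist x y)\<^sup>2) \<partial>\<pi>)"
    by (rule INF_lower)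
  also have "\<dots> = ennreal (1 / m) * (\<integral>\<^sup>+ z. ennreal ((dist (fst z) (snd z))\<^sup>2) \<partial>\<gamma>)"
    unfolding \<pi>_def split_beta
    by (rule nn_integral_scale_measure)
      (use measurable_dist2 in \<open>simp add: measurable_cong_sets[OF borel_measuresD(1)[OF \<gamma>] refl]\<close>)
  also have "\<dots> \<le> ennreal (1 / m) * ennreal c"
    by (intro mult_left_mono c) simp
  also have "\<dots> = ennreal (c / m)"
    using m c(2) by (simp flip: ennreal_mult)
  finally have "enn2real (INF \<pi>\<in>transport_plans \<mu>1 \<mu>2. \<integral>\<^sup>+ (x, y). ennreal ((dist x y)\<^sup>2) \<partial>\<pi>) \<le> c / m"
    using m c(2) by (metis divide_nonneg_pos enn2real_leI)
  then show ?thesis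
    using m by (simp add: W2_square field_simps flip: m_def)
qed

text \<open>The normalised product measure is a plan, and its cost is controlled by the two second
  moments. Finiteness matters because \<open>enn2real\<close> would silently turn an infinite
  infimum into 0.\<close>

lemma transport_cost_finite:
  fixes \<mu>1 \<mu>2 :: "'a::polish_space measure"
  assumes \<mu>1: "\<mu>1 \<in> borel_measures_2" and \<mu>2: "\<mu>2 \<in> borel_measures_2"
    and eq: "measure \<mu>1 UNIV = measure \<mu>2 UNIV" and pos: "measure \<mu>1 UNIV > 0"
  shows "(INF \<pi>\<in>transport_plans \<mu>1 \<mu>2. \<integral>\<^sup>+ (x, y). ennreal ((dist x y)\<^sup>2) \<partial>\<pi>) < \<infinity>"
proof -
  have b: "\<mu>1 \<in> borel_measures" "\<mu>2 \<in> borel_measures"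
    using assms by (auto simp: borel_measures_2_def)
  note B1 = borel_measuresD[OF b(1)] and B2 = borel_measuresD[OF b(2)]
  interpret A1: finite_measure \<mu>1 by (fact B1)
  interpret A2: finite_measure \<mu>2 by (fact B2)
  interpret pair_sigma_finite \<mu>1 \<mu>2 ..
  obtain x0 where x0: "(\<integral>\<^sup>+ x. ennreal ((dist x x0)\<^sup>2) \<partial>\<mu>1) < \<infinity>"
    using \<mu>1 by (auto simp: borel_measures_2_def)
  obtain y0 where y0: "(\<integral>\<^sup>+ x. ennreal ((dist x y0)\<^sup>2) \<partial>\<mu>2) < \<infinity>"
    using \<mu>2 by (auto simp: borel_measures_2_def)
  define m where "m = measure \<mu>1 UNIV"
  have m: "m > 0" "measure \<mu>2 UNIV = m"
    using eq pos by (auto simp: m_def)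
  have sP: "sets (\<mu>1 \<Otimes>\<^sub>M \<mu>2) = sets borel"
    using sets_pair_measure_cong[OF B1(1) B2(1)] unfolding borel_prod .
  have mc[measurable_cong]: "sets \<mu>1 = sets borel" "sets \<mu>2 = sets borel"
    by (fact B1 B2)+
  define \<pi> where "\<pi> = scale_measure (ennreal (1 / m\<^sup>2)) (\<mu>1 \<Otimes>\<^sub>M \<mu>2)"
  have em: "emeasure \<pi> (A \<times> C) = ennreal (measure \<mu>1 A * measure \<mu>2 C / m\<^sup>2)"
    if "A \<in> sets borel" "C \<in> sets borel" for A C
    using that
    by (simp add: \<pi>_def B1 B2 A2.emeasure_pair_measure_Times A1.emeasure_eq_measure A2.emeasure_eq_measure
        flip: ennreal_mult)
  have "emeasure \<pi> (space \<pi>) = 1"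
    using em[of UNIV UNIV] m by (simp add: \<pi>_def space_scale_measure space_pair_measure B1 B2 power2_eq_square flip: m_def)
  then have "prob_space \<pi>" by (rule prob_spaceI)
  moreover have "measure \<pi> (A \<times> C) = measure \<mu>1 A * measure \<mu>2 C / m\<^sup>2"
    if "A \<in> sets borel" "C \<in> sets borel" for A C
    using em[OF that] by (simp add: measure_def)
  ultimately have "\<pi> \<in> transport_plans \<mu>1 \<mu>2"
    using m by (auto simp: transport_plans_def \<pi>_def sP power2_eq_square simp flip: m_def)
  moreover have "(\<integral>\<^sup>+ (x, y). ennreal ((dist x y)\<^sup>2) \<partial>\<pi>) < \<infinity>"
  proof -
    \<comment> \<open>The second moments may come with different base points, which produces the
      middle term; the factor 3 is Cauchy-Schwarz for three summands.\<close>
    have tri: "(dist x y)\<^sup>2 \<le> 3 * (dist x x0)\<^sup>2 + 3 * (dist x0 y0)\<^sup>2 + 3 * (dist y y0)\<^sup>2" for x y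
    proof -
      have "dist x y \<le> dist x x0 + dist x0 y0 + dist y y0"
        using dist_triangle[of x y x0] dist_triangle[of x0 y y0] by (simp add: dist_commute)
      then have "(dist x y)\<^sup>2 \<le> (dist x x0 + dist x0 y0 + dist y y0)\<^sup>2"
        by (intro power_mono) auto
      moreover have "(u + v + w)\<^sup>2 \<le> 3 * u\<^sup>2 + 3 * v\<^sup>2 + 3 * w\<^sup>2" for u v w :: real
        using zero_le_power2[of "u - v"] zero_le_power2[of "v - w"] zero_le_power2[of "u - w"]
        by (simp add: power2_eq_square algebra_simps)
      ultimately show ?thesis by (rule order_trans)
    qed
    have dm: "(\<lambda>z. ennreal ((dist (fst z) (snd z))\<^sup>2)) \<in> borel_measurable (\<mu>1 \<Otimes>\<^sub>M \<mu>2)"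
      using measurable_dist2 by (simp add: measurable_cong_sets[OF sP refl])
    have "(\<integral>\<^sup>+ z. ennreal ((dist (fst z) (snd z))\<^sup>2) \<partial>(\<mu>1 \<Otimes>\<^sub>M \<mu>2)) =
        (\<integral>\<^sup>+ x. \<integral>\<^sup>+ y. ennreal ((dist x y)\<^sup>2) \<partial>\<mu>2 \<partial>\<mu>1)"
      using A2.nn_integral_fst[OF dm] by simp
    also have "\<dots> \<le> (\<integral>\<^sup>+ x. \<integral>\<^sup>+ y. 3 * ennreal ((dist x x0)\<^sup>2) + 3 * ennreal ((dist x0 y0)\<^sup>2)
        + 3 * ennreal ((dist y y0)\<^sup>2) \<partial>\<mu>2 \<partial>\<mu>1)"
    proof (intro nn_integral_mono)
      fix x y
      show "ennreal ((dist x y)\<^sup>2) \<le> 3 * ennreal ((dist x x0)\<^sup>2) + 3 * ennreal ((dist x0 y0)\<^sup>2)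
          + 3 * ennreal ((dist y y0)\<^sup>2)"
        using ennreal_leI[OF tri[of x y]] by (simp add: ennreal_mult)
    qed
    also have "\<dots> = (\<integral>\<^sup>+ x. (3 * ennreal ((dist x x0)\<^sup>2) + 3 * ennreal ((dist x0 y0)\<^sup>2)) * emeasure \<mu>2 UNIV
        + 3 * (\<integral>\<^sup>+ y. ennreal ((dist y y0)\<^sup>2) \<partial>\<mu>2) \<partial>\<mu>1)"
      by (simp add: nn_integral_add nn_integral_cmult B2)
    also have "\<dots> = (3 * (\<integral>\<^sup>+ x. ennreal ((dist x x0)\<^sup>2) \<partial>\<mu>1) + 3 * ennreal ((dist x0 y0)\<^sup>2) * emeasure \<mu>1 UNIV) * emeasure \<mu>2 UNIV
        + 3 * (\<integral>\<^sup>+ y. ennreal ((dist y y0)\<^sup>2) \<partial>\<mu>2) * emeasure \<mu>1 UNIV"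
      by (simp add: nn_integral_add nn_integral_cmult nn_integral_multc B1)
    also have "\<dots> < \<infinity>"
      using x0 y0 A1.emeasure_finite[of UNIV] A2.emeasure_finite[of UNIV]
      by (auto simp: ennreal_mult_eq_top_iff less_top[symmetric])
    finally have "(\<integral>\<^sup>+ z. ennreal ((dist (fst z) (snd z))\<^sup>2) \<partial>(\<mu>1 \<Otimes>\<^sub>M \<mu>2)) < \<infinity>" .
    then show ?thesis
      unfolding split_beta \<pi>_def nn_integral_scale_measure[OF dm]
      by (simp add: ennreal_mult_less_top)
  qed
  ultimately show ?thesis
    by (meson INF_lower le_less_trans)
qed

lemma W2_square_plan:
  fixes \<mu>1 \<mu>2 :: "'a::polish_space measure"
  assumes \<mu>1: "\<mu>1 \<in> borel_measures_2" and \<mu>2: "\<mu>2 \<in> borel_measures_2"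
    and eq: "measure \<mu>1 UNIV = measure \<mu>2 UNIV" and "\<epsilon> > 0"
  obtains \<gamma> :: "('a \<times> 'a) measure" where "\<gamma> \<in> borel_measures"
    "\<And>A. A \<in> sets borel \<Longrightarrow> emeasure \<gamma> (A \<times> UNIV) = emeasure \<mu>1 A"
    "\<And>A. A \<in> sets borel \<Longrightarrow> emeasure \<gamma> (UNIV \<times> A) = emeasure \<mu>2 A"
    "(\<integral>\<^sup>+ z. ennreal ((dist (fst z) (snd z))\<^sup>2) \<partial>\<gamma>) \<le> ennreal ((W2 \<mu>1 \<mu>2)\<^sup>2 + \<epsilon>)"
proof -
  have b: "\<mu>1 \<in> borel_measures" "\<mu>2 \<in> borel_measures"
    using assms by (auto simp: borel_measures_2_def)
  note B1 = borel_measuresD[OF b(1)] and B2 = borel_measuresD[OF b(2)]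
  interpret A1: finite_measure \<mu>1 by (fact B1)
  interpret A2: finite_measure \<mu>2 by (fact B2)
  define m where "m = measure \<mu>1 UNIV"
  have m0: "m \<ge> 0" "measure \<mu>2 UNIV = m"
    using eq by (simp_all add: m_def)
  show ?thesis
  proof (cases "m = 0")
    case True
    have "measure \<mu>1 A \<le> 0" "measure \<mu>2 A \<le> 0" for A
      using A1.bounded_measure[of A] A2.bounded_measure[of A] m0(2) True
      by (auto simp: m_def B1 B2)
    then have "emeasure \<mu>1 A = 0" "emeasure \<mu>2 A = 0" for A
      by (auto simp: A1.emeasure_eq_measure A2.emeasure_eq_measure measure_le_0_iff)
    moreover have "(\<integral>\<^sup>+ z. ennreal ((dist (fst z) (snd z))\<^sup>2) \<partial>(null_measure borel :: ('a \<times> 'a) measure)) = 0"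
      by (simp add: nn_integral_null_measure)
    ultimately show ?thesis
      by (intro that[of "null_measure borel"]) (simp_all add: borel_measures_null)
  next
    case False
    then have m: "m > 0" using m0 by simp
    define J where "J = (INF \<pi>\<in>transport_plans \<mu>1 \<mu>2. \<integral>\<^sup>+ (x, y). ennreal ((dist x y)\<^sup>2) \<partial>\<pi>)"
    have J: "J < \<infinity>"
      unfolding J_def using transport_cost_finite[OF \<mu>1 \<mu>2 eq] m by (simp add: m_def)
    \<comment> \<open>The slack is \<epsilon>/m because the plan is multiplied by \<open>m\<close>
      afterwards. Strictness uses that \<open>J\<close> is finite.\<close>
    then have "J < J + ennreal (\<epsilon> / m)"
      using m \<open>\<epsilon> > 0\<close> by (cases J) (auto simp: ennreal_less_iff simp flip: ennreal_plus)
    then obtain \<pi> where \<pi>: "\<pi> \<in> transport_plans \<mu>1 \<mu>2"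
      "(\<integral>\<^sup>+ (x, y). ennreal ((dist x y)\<^sup>2) \<partial>\<pi>) < J + ennreal (\<epsilon> / m)"
      unfolding J_def by (auto simp: INF_less_iff)
    then have s\<pi>: "sets \<pi> = sets borel" and p\<pi>: "prob_space \<pi>"
      and fst: "\<And>A. A \<in> sets borel \<Longrightarrow> m * measure \<pi> (A \<times> UNIV) = measure \<mu>1 A"
      and snd: "\<And>A. A \<in> sets borel \<Longrightarrow> m * measure \<pi> (UNIV \<times> A) = measure \<mu>2 A"
      by (auto simp: transport_plans_def m0 simp flip: m_def)
    interpret \<pi>: prob_space \<pi> by fact
    define \<gamma> where "\<gamma> = scale_measure (ennreal m) \<pi>"
    show ?thesis
    proof (rule that[of \<gamma>])
      show "\<gamma> \<in> borel_measures"
        by (intro borel_measuresI finite_measureI)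
          (auto simp: \<gamma>_def s\<pi> space_scale_measure \<pi>.emeasure_space_1)
      show "emeasure \<gamma> (A \<times> UNIV) = emeasure \<mu>1 A" "emeasure \<gamma> (UNIV \<times> A) = emeasure \<mu>2 A"
        if "A \<in> sets borel" for A
        using fst[OF that] snd[OF that] m
        by (simp_all add: \<gamma>_def \<pi>.emeasure_eq_measure A1.emeasure_eq_measure A2.emeasure_eq_measure
            flip: ennreal_mult)
      have "(\<integral>\<^sup>+ z. ennreal ((dist (fst z) (snd z))\<^sup>2) \<partial>\<gamma>) =
          ennreal m * (\<integral>\<^sup>+ z. ennreal ((dist (fst z) (snd z))\<^sup>2) \<partial>\<pi>)"
        unfolding \<gamma>_def
        by (rule nn_integral_scale_measure)
          (use measurable_dist2 in \<open>simp add: measurable_cong_sets[OF s\<pi> refl]\<close>)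
      also have "\<dots> \<le> ennreal m * (J + ennreal (\<epsilon> / m))"
        using \<pi>(2) by (intro mult_left_mono) (auto simp: case_prod_beta')
      also have "\<dots> = ennreal (m * enn2real J + \<epsilon>)"
        using J m \<open>\<epsilon> > 0\<close>
        by (cases J) (auto simp: algebra_simps simp flip: ennreal_plus ennreal_mult)
      finally show "(\<integral>\<^sup>+ z. ennreal ((dist (fst z) (snd z))\<^sup>2) \<partial>\<gamma>) \<le> ennreal ((W2 \<mu>1 \<mu>2)\<^sup>2 + \<epsilon>)"
        by (simp add: W2_square J_def m_def)
    qed
  qed
qed

section \<open>Partial transport\<close>

text \<open>The marginal conditions are inequalities between unnormalised measures, so the set
  always contains the zero measure and is stable under weak limits even when \<open>\<rho>\<close>
  varies.\<close>

definition partial_plans ::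
    "'a::metric_space measure \<Rightarrow> 'a measure \<Rightarrow> ('a \<times> 'a) measure set" where
  "partial_plans \<mu> \<rho> = {\<gamma> \<in> borel_measures.
     (\<forall>A\<in>sets borel. emeasure \<gamma> (A \<times> UNIV) \<le> emeasure \<mu> A) \<and>
     (\<forall>B\<in>sets borel. emeasure \<gamma> (UNIV \<times> B) \<le> emeasure \<rho> B)}"

text \<open>The factor 2 arises because both marginals have the mass of \<open>\<gamma>\<close>. The
  integral is a Bochner integral, which defaults to 0 for a non-integrable distance; upper bounds on
  the generalized distance therefore have to establish integrability, and they take it from plans
  living on a compact set.\<close>

definition partial_cost ::
    "real \<Rightarrow> real \<Rightarrow> 'a::metric_space measure \<Rightarrow> 'a measure \<Rightarrow> ('a \<times> 'a) measure \<Rightarrow> real" where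
  "partial_cost a b \<mu> \<rho> \<gamma> =
     a * (measure \<mu> UNIV + measure \<rho> UNIV - 2 * measure \<gamma> UNIV)
     + b\<^sup>2 * (\<integral>z. (dist (fst z) (snd z))\<^sup>2 \<partial>\<gamma>)"

definition generalized_W2_costs ::
    "real \<Rightarrow> real \<Rightarrow> 'a::metric_space measure \<Rightarrow> 'a measure \<Rightarrow> real set" where
  "generalized_W2_costs a b \<mu>1 \<mu>2 =
     {a * total_mass (\<lambda>A. measure \<mu>1 A - measure \<mu>1' A)
      + a * total_mass (\<lambda>A. measure \<mu>2 A - measure \<mu>2' A)
      + b\<^sup>2 * (W2 \<mu>1' \<mu>2')\<^sup>2 | \<mu>1' \<mu>2'.
        \<mu>1' \<in> borel_measures_2 \<and> \<mu>2' \<in> borel_measures_2 \<and>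
        measure \<mu>1' UNIV = measure \<mu>2' UNIV}"

lemma generalized_W2_costs_nonneg:
  assumes "a > 0" "\<mu>1 \<in> borel_measures" "\<mu>2 \<in> borel_measures" "c \<in> generalized_W2_costs a b \<mu>1 \<mu>2"
  shows "0 \<le> c"
  using assms by (auto simp: generalized_W2_costs_def borel_measures_2_def intro!: add_nonneg_nonneg
      mult_nonneg_nonneg total_mass_nonneg)

lemma generalized_W2_costs_nonempty: "generalized_W2_costs a b \<mu>1 \<mu>2 \<noteq> {}"
proof -
  have "null_measure borel \<in> borel_measures_2"
    by (simp add: borel_measures_2_def borel_measures_null nn_integral_null_measure)
  then show ?thesis
    unfolding generalized_W2_costs_def by blast
qed

lemma generalized_W2_square:
  assumes "a > 0" "\<mu>1 \<in> borel_measures" "\<mu>2 \<in> borel_measures"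
  shows "(generalized_W2 a b \<mu>1 \<mu>2)\<^sup>2 = Inf (generalized_W2_costs a b \<mu>1 \<mu>2)"
  unfolding generalized_W2_def generalized_W2_costs_def[symmetric]
  by (intro real_sqrt_pow2 cInf_greatest generalized_W2_costs_nonempty
      generalized_W2_costs_nonneg[OF assms])

section \<open>Comparison of partial plans with the generalized distance\<close>

lemma emeasure_Compl_eq_0:
  fixes \<mu> :: "'a::metric_space measure"
  assumes "closed K" "\<mu> \<in> borel_measures" "AE x in \<mu>. x \<in> K"
  shows "emeasure \<mu> (- K) = 0"
proof -
  have "- K \<in> sets borel"
    using assms(1) by auto
  then show ?thesis
    using assms(3) AE_iff_measurable[of "- K" \<mu> "\<lambda>x. x \<in> K"] borel_measuresD[OF assms(2)]
    by (auto simp: Compl_eq)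
qed

text \<open>The complement of \<open>K \<times> K\<close> is covered by two strips, each of which is
  null because the corresponding marginal is dominated by a measure that does not charge the
  complement of \<open>K\<close>.\<close>

lemma partial_plans_AE:
  fixes K :: "'a::polish_space set"
  assumes K: "closed K" and \<gamma>: "\<gamma> \<in> partial_plans \<mu> \<rho>"
    and \<mu>: "\<mu> \<in> borel_measures" "AE x in \<mu>. x \<in> K" and \<rho>: "\<rho> \<in> borel_measures" "AE x in \<rho>. x \<in> K"
  shows "AE z in \<gamma>. z \<in> K \<times> K"
proof -
  have \<gamma>b: "\<gamma> \<in> borel_measures"
    using \<gamma> by (simp add: partial_plans_def)
  have cK: "- K \<in> sets borel"
    using K by auto
  have "emeasure \<gamma> ((- K) \<times> UNIV) = 0" "emeasure \<gamma> (UNIV \<times> (- K)) = 0"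
  proof -
    have "emeasure \<gamma> ((- K) \<times> UNIV) \<le> emeasure \<mu> (- K)" "emeasure \<gamma> (UNIV \<times> (- K)) \<le> emeasure \<rho> (- K)"
      using \<gamma> cK by (simp_all add: partial_plans_def)
    then show "emeasure \<gamma> ((- K) \<times> UNIV) = 0" "emeasure \<gamma> (UNIV \<times> (- K)) = 0"
      using emeasure_Compl_eq_0[OF K \<mu>] emeasure_Compl_eq_0[OF K \<rho>] by simp_all
  qed
  moreover have "(- K) \<times> UNIV \<in> sets \<gamma>" "UNIV \<times> (- K) \<in> sets \<gamma>"
    using K by (auto simp: borel_measuresD(1)[OF \<gamma>b] intro!: borel_open open_Times)
  ultimately have "(- K) \<times> UNIV \<union> UNIV \<times> (- K) \<in> null_sets \<gamma>"
    by auto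
  then show ?thesis
    by (rule AE_I') auto
qed

text \<open>The two marginals of \<open>\<gamma>\<close> compete in the infimum. They share one
  mass, boundedness of \<open>K\<close> gives them finite second moments, and domination turns their
  total variation terms into the mass terms of \<open>partial_cost\<close>.\<close>

lemma generalized_W2_le_partial_cost:
  fixes K :: "'a::polish_space set"
  assumes "a > 0" and K: "compact K" and \<gamma>: "\<gamma> \<in> partial_plans \<mu> \<rho>"
    and \<mu>: "\<mu> \<in> borel_measures" "AE x in \<mu>. x \<in> K" and \<rho>: "\<rho> \<in> borel_measures" "AE x in \<rho>. x \<in> K"
  shows "(generalized_W2 a b \<mu> \<rho>)\<^sup>2 \<le> partial_cost a b \<mu> \<rho> \<gamma>"
proof -
  have \<gamma>b: "\<gamma> \<in> borel_measures"
    using \<gamma> by (simp add: partial_plans_def)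
  note B = borel_measuresD[OF \<gamma>b]
  interpret \<gamma>: finite_measure \<gamma> by (fact B)
  have mc[measurable_cong]: "sets \<gamma> = sets borel" by (fact B)
  note measurable_pair_borel[measurable] measurable_dist2[measurable]
  have KK: "AE z in \<gamma>. z \<in> K \<times> K"
    by (rule partial_plans_AE[OF compact_imp_closed[OF K] \<gamma> \<mu> \<rho>])
  define \<alpha> where "\<alpha> = distr \<gamma> borel fst"
  define \<beta> where "\<beta> = distr \<gamma> borel snd"
  have \<alpha>b: "\<alpha> \<in> borel_measures" and \<beta>b: "\<beta> \<in> borel_measures"
    unfolding \<alpha>_def \<beta>_def by (intro borel_measures_distr \<gamma>b measurable_pair_borel)+
  have e\<alpha>: "emeasure \<alpha> A = emeasure \<gamma> (A \<times> UNIV)" and e\<beta>: "emeasure \<beta> A = emeasure \<gamma> (UNIV \<times> A)"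
    if "A \<in> sets borel" for A
    using that by (simp_all add: \<alpha>_def \<beta>_def emeasure_distr_fst emeasure_distr_snd \<gamma>b)
  have mass: "measure \<alpha> UNIV = measure \<gamma> UNIV" "measure \<beta> UNIV = measure \<gamma> UNIV"
    by (simp_all add: measure_def e\<alpha> e\<beta>)
  obtain x0 :: 'a and D where D: "\<And>x. x \<in> K \<Longrightarrow> dist x0 x \<le> D"
    using compact_imp_bounded[OF K] bounded_def by metis
  have D2: "(dist x x0)\<^sup>2 \<le> D\<^sup>2" if "x \<in> K" for x
    using D[OF that] by (intro power_mono) (auto simp: dist_commute)
  have "(\<integral>\<^sup>+ x. ennreal ((dist x x0)\<^sup>2) \<partial>\<alpha>) < \<infinity>" "(\<integral>\<^sup>+ x. ennreal ((dist x x0)\<^sup>2) \<partial>\<beta>) < \<infinity>"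
  proof -
    have fin: "(\<integral>\<^sup>+ z. ennreal ((dist (f z) x0)\<^sup>2) \<partial>\<gamma>) < \<infinity>" if "AE z in \<gamma>. f z \<in> K" for f :: "_ \<Rightarrow> 'a"
    proof -
      have "(\<integral>\<^sup>+ z. ennreal ((dist (f z) x0)\<^sup>2) \<partial>\<gamma>) \<le> (\<integral>\<^sup>+ z. ennreal (D\<^sup>2) \<partial>\<gamma>)"
        using that by (intro nn_integral_mono_AE) (auto elim!: eventually_mono intro!: ennreal_leI D2)
      also have "\<dots> < \<infinity>"
        using \<gamma>.emeasure_finite by (simp add: ennreal_mult_eq_top_iff less_top[symmetric])
      finally show ?thesis .
    qed
    have dm: "(\<lambda>x. ennreal ((dist x x0)\<^sup>2)) \<in> borel_measurable borel"
      by (intro measurable_compose[OF _ measurable_ennreal] borel_measurable_continuous_onI continuous_intros)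
    have "AE z in \<gamma>. fst z \<in> K" "AE z in \<gamma>. snd z \<in> K"
      using KK by (auto elim!: eventually_mono)
    from this[THEN fin]
    show "(\<integral>\<^sup>+ x. ennreal ((dist x x0)\<^sup>2) \<partial>\<alpha>) < \<infinity>" "(\<integral>\<^sup>+ x. ennreal ((dist x x0)\<^sup>2) \<partial>\<beta>) < \<infinity>"
      unfolding \<alpha>_def \<beta>_def using dm by (simp_all add: nn_integral_distr)
  qed
  then have ab2: "\<alpha> \<in> borel_measures_2" "\<beta> \<in> borel_measures_2"
    using \<alpha>b \<beta>b by (auto simp: borel_measures_2_def)
  obtain D' where D': "\<And>x y. x \<in> K \<Longrightarrow> y \<in> K \<Longrightarrow> dist x y \<le> D'"
    using compact_imp_bounded[OF K] bounded_two_points by metis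
  have d2m[measurable]: "(\<lambda>z. (dist (fst z) (snd z))\<^sup>2) \<in> borel_measurable (borel :: ('a \<times> 'a) measure)"
    by (intro borel_measurable_continuous_onI continuous_intros)
  have int: "integrable \<gamma> (\<lambda>z. (dist (fst z) (snd z))\<^sup>2)"
    by (rule \<gamma>.integrable_const_bound[of _ "D'\<^sup>2"])
      (use KK in \<open>auto elim!: eventually_mono intro!: power_mono D'\<close>)
  have W2: "(W2 \<alpha> \<beta>)\<^sup>2 \<le> (\<integral>z. (dist (fst z) (snd z))\<^sup>2 \<partial>\<gamma>)"
  proof (rule W2_square_le[OF \<alpha>b \<beta>b \<gamma>b])
    show "(\<integral>\<^sup>+ z. ennreal ((dist (fst z) (snd z))\<^sup>2) \<partial>\<gamma>) \<le> ennreal (\<integral>z. (dist (fst z) (snd z))\<^sup>2 \<partial>\<gamma>)"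
      by (subst nn_integral_eq_integral[OF int]) auto
  qed (simp_all add: e\<alpha> e\<beta>)
  have le: "emeasure \<alpha> A \<le> emeasure \<mu> A" "emeasure \<beta> A \<le> emeasure \<rho> A" if "A \<in> sets borel" for A
    using \<gamma> that by (auto simp: partial_plans_def e\<alpha> e\<beta>)
  have "a * total_mass (\<lambda>A. measure \<mu> A - measure \<alpha> A) + a * total_mass (\<lambda>A. measure \<rho> A - measure \<beta> A)
      + b\<^sup>2 * (W2 \<alpha> \<beta>)\<^sup>2 \<in> generalized_W2_costs a b \<mu> \<rho>"
    unfolding generalized_W2_costs_def
    by (rule CollectI, rule exI[of _ \<alpha>], rule exI[of _ \<beta>]) (simp add: ab2 mass)
  then have "Inf (generalized_W2_costs a b \<mu> \<rho>) \<le> a * total_mass (\<lambda>A. measure \<mu> A - measure \<alpha> A)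
      + a * total_mass (\<lambda>A. measure \<rho> A - measure \<beta> A) + b\<^sup>2 * (W2 \<alpha> \<beta>)\<^sup>2"
    using generalized_W2_costs_nonneg[OF \<open>a > 0\<close> \<mu>(1) \<rho>(1)]
    by (intro cInf_lower bdd_belowI[of _ 0]) auto
  also have "\<dots> \<le> partial_cost a b \<mu> \<rho> \<gamma>"
    using mult_left_mono[OF W2, of "b\<^sup>2"]
    by (simp add: partial_cost_def total_mass_diff[OF \<mu>(1) \<alpha>b le(1)] total_mass_diff[OF \<rho>(1) \<beta>b le(2)]
        mass algebra_simps)
  finally show ?thesis
    by (simp add: generalized_W2_square[OF \<open>a > 0\<close> \<mu>(1) \<rho>(1)])
qed

text \<open>A near-optimal plan between \<open>\<alpha>\<close> and \<open>\<beta>\<close> is cut down to one with marginals below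
  \<open>\<mu>\<close> and \<open>\<rho>\<close>: the densities \<open>f\<close> and \<open>g\<close> of the common parts satisfy
  \<open>f x * g y \<ge> f x + g y - 1\<close>, so the mass that is lost is already paid for by the total
  variation terms.\<close>

lemma partial_plan_near_optimal:
  fixes \<mu> \<rho> :: "'a::polish_space measure"
  assumes "a > 0" and \<mu>: "\<mu> \<in> borel_measures" and \<rho>: "\<rho> \<in> borel_measures" and "\<epsilon> > 0"
  obtains \<gamma> where "\<gamma> \<in> partial_plans \<mu> \<rho>"
    "partial_cost a b \<mu> \<rho> \<gamma> \<le> (generalized_W2 a b \<mu> \<rho>)\<^sup>2 + \<epsilon>"
proof -
  have "Inf (generalized_W2_costs a b \<mu> \<rho>) < (generalized_W2 a b \<mu> \<rho>)\<^sup>2 + \<epsilon> / 2"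
    using \<open>\<epsilon> > 0\<close> by (simp add: generalized_W2_square[OF \<open>a > 0\<close> \<mu> \<rho>])
  then obtain c where c: "c \<in> generalized_W2_costs a b \<mu> \<rho>"
    "c < (generalized_W2 a b \<mu> \<rho>)\<^sup>2 + \<epsilon> / 2"
    using cInf_lessD[OF generalized_W2_costs_nonempty] by blast
  then obtain \<alpha> \<beta> where \<alpha>\<beta>: "\<alpha> \<in> borel_measures_2" "\<beta> \<in> borel_measures_2"
    and mass: "measure \<alpha> UNIV = measure \<beta> UNIV"
    and c_eq: "c = a * total_mass (\<lambda>A. measure \<mu> A - measure \<alpha> A)
      + a * total_mass (\<lambda>A. measure \<rho> A - measure \<beta> A) + b\<^sup>2 * (W2 \<alpha> \<beta>)\<^sup>2"
    by (auto simp: generalized_W2_costs_def)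
  then have \<alpha>b: "\<alpha> \<in> borel_measures" and \<beta>b: "\<beta> \<in> borel_measures"
    by (auto simp: borel_measures_2_def)
  \<comment> \<open>Half of \<epsilon> pays for the choice of the competitor, the other half for the
    plan, whose error is multiplied by \<open>b\<^sup>2\<close>. The added 1 keeps the denominator
    positive for every \<open>b\<close>.\<close>
  define \<delta> where "\<delta> = \<epsilon> / (2 * (b\<^sup>2 + 1))"
  have b1: "b\<^sup>2 + 1 > 0"
    using zero_le_power2[of b] by linarith
  have \<delta>: "\<delta> > 0" "b\<^sup>2 * \<delta> \<le> \<epsilon> / 2"
    using \<open>\<epsilon> > 0\<close> b1 by (auto simp: \<delta>_def field_simps)
  obtain \<gamma> :: "('a \<times> 'a) measure" where \<gamma>b: "\<gamma> \<in> borel_measures"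
    and fst: "\<And>A. A \<in> sets borel \<Longrightarrow> emeasure \<gamma> (A \<times> UNIV) = emeasure \<alpha> A"
    and snd: "\<And>A. A \<in> sets borel \<Longrightarrow> emeasure \<gamma> (UNIV \<times> A) = emeasure \<beta> A"
    and cost: "(\<integral>\<^sup>+ z. ennreal ((dist (fst z) (snd z))\<^sup>2) \<partial>\<gamma>) \<le> ennreal ((W2 \<alpha> \<beta>)\<^sup>2 + \<delta>)"
    by (rule W2_square_plan[OF \<alpha>\<beta> mass \<delta>(1)], rule that)
  obtain f :: "'a \<Rightarrow> real" where f[measurable]: "f \<in> borel_measurable borel"
    and f01: "\<And>x. 0 \<le> f x" "\<And>x. f x \<le> 1"
    and fle: "\<And>A. A \<in> sets borel \<Longrightarrow> (\<integral>\<^sup>+ x. ennreal (f x) * indicator A x \<partial>\<alpha>) \<le> emeasure \<mu> A"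
    and ftm: "measure \<mu> UNIV + measure \<alpha> UNIV - 2 * (\<integral>x. f x \<partial>\<alpha>) \<le>
      total_mass (\<lambda>A. measure \<mu> A - measure \<alpha> A)"
    by (rule common_part_density[OF \<mu> \<alpha>b], rule that)
  obtain g :: "'a \<Rightarrow> real" where g[measurable]: "g \<in> borel_measurable borel"
    and g01: "\<And>x. 0 \<le> g x" "\<And>x. g x \<le> 1"
    and gle: "\<And>A. A \<in> sets borel \<Longrightarrow> (\<integral>\<^sup>+ x. ennreal (g x) * indicator A x \<partial>\<beta>) \<le> emeasure \<rho> A"
    and gtm: "measure \<rho> UNIV + measure \<beta> UNIV - 2 * (\<integral>x. g x \<partial>\<beta>) \<le>
      total_mass (\<lambda>A. measure \<rho> A - measure \<beta> A)"
    by (rule common_part_density[OF \<rho> \<beta>b], rule that)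
  note B = borel_measuresD[OF \<gamma>b]
  interpret \<gamma>: finite_measure \<gamma> by (fact B)
  have mc[measurable_cong]: "sets \<gamma> = sets borel" by (fact B)
  note measurable_pair_borel[measurable] measurable_dist2[measurable]
  have distr: "distr \<gamma> borel fst = \<alpha>" "distr \<gamma> borel snd = \<beta>"
    by (rule measure_eqI;
        simp add: emeasure_distr_fst emeasure_distr_snd \<gamma>b fst snd borel_measuresD(1)[OF \<alpha>b] borel_measuresD(1)[OF \<beta>b])+
  define w where "w z = f (fst z) * g (snd z)" for z
  have w[measurable]: "w \<in> borel_measurable borel"
    unfolding w_def by measurable
  have w01: "0 \<le> w z" "w z \<le> 1" "w z \<le> f (fst z)" "w z \<le> g (snd z)" for z
    using f01 g01 by (auto simp: w_def mult_le_one mult_left_le mult_left_le_one_le)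
  have w_le: "w (x, y) \<le> f x" "w (x, y) \<le> g y" for x y
    using w01(3,4)[of "(x, y)"] by simp_all
  have wfg: "f (fst z) + g (snd z) - 1 \<le> w z" for z
    using mult_nonneg_nonneg[of "1 - f (fst z)" "1 - g (snd z)"] f01 g01
    by (simp add: w_def algebra_simps)
  define \<eta> where "\<eta> = density \<gamma> (\<lambda>z. ennreal (w z))"
  have \<eta>s: "sets \<eta> = sets borel"
    by (simp add: \<eta>_def B)
  have \<eta>e: "emeasure \<eta> A = (\<integral>\<^sup>+ z. ennreal (w z) * indicator A z \<partial>\<gamma>)" if "A \<in> sets borel" for A
    unfolding \<eta>_def by (rule emeasure_density) (use that in \<open>auto simp: B\<close>)
  have wint: "integrable \<gamma> w"
    by (rule \<gamma>.integrable_const_bound[of _ 1]) (auto simp: w01)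
  have fint: "integrable \<gamma> (\<lambda>z. f (fst z))" and gint: "integrable \<gamma> (\<lambda>z. g (snd z))"
    by (rule \<gamma>.integrable_const_bound[of _ 1]; simp add: f01 g01)+
  have \<eta>U: "emeasure \<eta> UNIV = ennreal (\<integral>z. w z \<partial>\<gamma>)"
    using \<eta>e[of UNIV] nn_integral_eq_integral[OF wint] w01 by simp
  have \<eta>b: "\<eta> \<in> borel_measures"
    using \<eta>s \<eta>U sets_eq_imp_space_eq[OF \<eta>s] by (intro borel_measuresI finite_measureI) auto
  \<comment> \<open>The pointwise bound \<open>wfg\<close> integrated over \<open>\<gamma>\<close>,
    whose marginals are exactly \<open>\<alpha>\<close> and \<open>\<beta>\<close>.\<close>
  have \<eta>mass: "(\<integral>x. f x \<partial>\<alpha>) + (\<integral>x. g x \<partial>\<beta>) - measure \<alpha> UNIV \<le> measure \<eta> UNIV"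
  proof -
    have "measure \<alpha> UNIV = measure \<gamma> UNIV"
      using fst[of UNIV] by (simp add: measure_def)
    then have "(\<integral>x. f x \<partial>\<alpha>) + (\<integral>x. g x \<partial>\<beta>) - measure \<alpha> UNIV
        = (\<integral>z. f (fst z) + g (snd z) - 1 \<partial>\<gamma>)"
      using fint gint by (simp add: distr[symmetric] integral_distr B)
    also have "\<dots> \<le> (\<integral>z. w z \<partial>\<gamma>)"
      using fint gint wint wfg by (intro integral_mono) auto
    also have "\<dots> = measure \<eta> UNIV"
      using \<eta>U w01 by (simp add: measure_def)
    finally show ?thesis .
  qed
  have "\<eta> \<in> partial_plans \<mu> \<rho>"
    unfolding partial_plans_def
  proof (intro CollectI conjI ballI \<eta>b)
    fix A :: "'a set" assume A[measurable]: "A \<in> sets borel"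
    have "A \<times> UNIV \<in> sets (borel :: ('a \<times> 'a) measure)" "UNIV \<times> A \<in> sets (borel :: ('a \<times> 'a) measure)"
      by (auto intro!: borel_Times)
    note \<eta>A = this[THEN \<eta>e]
    have "emeasure \<eta> (A \<times> UNIV) \<le> (\<integral>\<^sup>+ z. ennreal (f (fst z)) * indicator A (fst z) \<partial>\<gamma>)"
      unfolding \<eta>A by (intro nn_integral_mono) (auto simp: w_le indicator_def intro!: ennreal_leI)
    also have "\<dots> = (\<integral>\<^sup>+ x. ennreal (f x) * indicator A x \<partial>\<alpha>)"
      unfolding distr(1)[symmetric] by (subst nn_integral_distr) auto
    also have "\<dots> \<le> emeasure \<mu> A" by (rule fle) fact
    finally show "emeasure \<eta> (A \<times> UNIV) \<le> emeasure \<mu> A" .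
    have "emeasure \<eta> (UNIV \<times> A) \<le> (\<integral>\<^sup>+ z. ennreal (g (snd z)) * indicator A (snd z) \<partial>\<gamma>)"
      unfolding \<eta>A by (intro nn_integral_mono) (auto simp: w_le indicator_def intro!: ennreal_leI)
    also have "\<dots> = (\<integral>\<^sup>+ x. ennreal (g x) * indicator A x \<partial>\<beta>)"
      unfolding distr(2)[symmetric] by (subst nn_integral_distr) auto
    also have "\<dots> \<le> emeasure \<rho> A" by (rule gle) fact
    finally show "emeasure \<eta> (UNIV \<times> A) \<le> emeasure \<rho> A" .
  qed
  moreover have "partial_cost a b \<mu> \<rho> \<eta> \<le> (generalized_W2 a b \<mu> \<rho>)\<^sup>2 + \<epsilon>"
  proof -
    have d2: "(\<lambda>z. (dist (fst z) (snd z))\<^sup>2) \<in> borel_measurable \<eta>"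
      unfolding measurable_cong_sets[OF \<eta>s refl]
      by (intro borel_measurable_continuous_onI continuous_intros)
    have "(\<integral>\<^sup>+ z. ennreal ((dist (fst z) (snd z))\<^sup>2) \<partial>\<eta>) =
        (\<integral>\<^sup>+ z. ennreal (w z) * ennreal ((dist (fst z) (snd z))\<^sup>2) \<partial>\<gamma>)"
      unfolding \<eta>_def by (rule nn_integral_density) auto
    also have "\<dots> \<le> (\<integral>\<^sup>+ z. 1 * ennreal ((dist (fst z) (snd z))\<^sup>2) \<partial>\<gamma>)"
      by (intro nn_integral_mono mult_right_mono) (auto simp: w01)
    also have "\<dots> \<le> ennreal ((W2 \<alpha> \<beta>)\<^sup>2 + \<delta>)"
      using cost by simp
    \<comment> \<open>The extended integral is finite, so it agrees with the Bochner integral of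
      \<open>partial_cost\<close>; here integrability comes from the cost of
      \<open>\<gamma>\<close>, not from compactness.\<close>
    finally have "(\<integral>z. (dist (fst z) (snd z))\<^sup>2 \<partial>\<eta>) \<le> (W2 \<alpha> \<beta>)\<^sup>2 + \<delta>"
      using \<delta>(1) by (subst integral_eq_nn_integral[OF d2]) (auto intro!: enn2real_leI add_nonneg_nonneg)
    then have "b\<^sup>2 * (\<integral>z. (dist (fst z) (snd z))\<^sup>2 \<partial>\<eta>) \<le> b\<^sup>2 * ((W2 \<alpha> \<beta>)\<^sup>2 + \<delta>)"
      by (rule mult_left_mono) simp
    \<comment> \<open>Adding \<open>ftm\<close> and \<open>gtm\<close> and using that
      \<open>\<alpha>\<close> and \<open>\<beta>\<close> have equal mass, the lower bound
      \<open>\<eta>mass\<close> enters with exactly the factor 2 of the mass term.\<close>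
    moreover have "a * (measure \<mu> UNIV + measure \<rho> UNIV - 2 * measure \<eta> UNIV) \<le>
        a * (total_mass (\<lambda>A. measure \<mu> A - measure \<alpha> A) + total_mass (\<lambda>A. measure \<rho> A - measure \<beta> A))"
      using \<open>a > 0\<close> ftm gtm \<eta>mass mass by (intro mult_left_mono) linarith+
    ultimately have "partial_cost a b \<mu> \<rho> \<eta> \<le> c + b\<^sup>2 * \<delta>"
      by (simp add: partial_cost_def c_eq algebra_simps)
    with c(2) \<delta>(2) show ?thesis by linarith
  qed
  ultimately show ?thesis
    by (rule that)
qed

section \<open>Existence of a minimizer\<close>

text \<open>Every point outside the support has an open null neighbourhood, and by the Lindelof
  property countably many of these cover the complement of the support. With
  \<open>msupport_subset_closed\<close> as converse, the support constraint becomes an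
  almost-everywhere statement.\<close>

lemma AE_in_superset_msupport:
  fixes \<mu> :: "'a::polish_space measure"
  assumes \<mu>: "\<mu> \<in> borel_measures" and "msupport \<mu> \<subseteq> K"
  shows "AE x in \<mu>. x \<in> K"
proof -
  define \<F> where "\<F> = {U. open U \<and> emeasure \<mu> U = 0}"
  obtain \<F>' where \<F>': "\<F>' \<subseteq> \<F>" "countable \<F>'" "\<Union>\<F>' = \<Union>\<F>"
    using Lindelof[of \<F>] by (auto simp: \<F>_def)
  have "U \<in> null_sets \<mu>" if "U \<in> \<F>'" for U
    using that \<F>'(1) borel_measuresD(1)[OF \<mu>] by (auto simp: \<F>_def null_sets_def)
  then have "(\<Union>U\<in>\<F>'. U) \<in> null_sets \<mu>"
    by (rule null_sets_UN'[OF \<F>'(2)])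
  moreover have "{x \<in> space \<mu>. x \<notin> K} \<subseteq> (\<Union>U\<in>\<F>'. U)"
  proof
    fix x assume "x \<in> {x \<in> space \<mu>. x \<notin> K}"
    then have "x \<notin> msupport \<mu>"
      using assms(2) by auto
    then obtain U where "open U" "x \<in> U" "emeasure \<mu> U = 0"
      by (auto simp: msupport_def)
    then have "x \<in> \<Union>\<F>"
      by (auto simp: \<F>_def)
    then show "x \<in> (\<Union>U\<in>\<F>'. U)"
      using \<F>'(3) by simp
  qed
  ultimately show ?thesis
    by (rule AE_I')
qed

lemma msupport_subset_closed:
  fixes \<mu> :: "'a::metric_space measure"
  assumes \<mu>: "\<mu> \<in> borel_measures" and K: "closed K" "AE x in \<mu>. x \<in> K"
  shows "msupport \<mu> \<subseteq> K"
proof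
  fix x assume x: "x \<in> msupport \<mu>"
  show "x \<in> K"
  proof (rule ccontr)
    assume "x \<notin> K"
    have "emeasure \<mu> (- K) = 0"
      by (rule emeasure_Compl_eq_0[OF K(1) \<mu> K(2)])
    moreover have "open (- K)" "x \<in> - K"
      using K(1) \<open>x \<notin> K\<close> by auto
    ultimately show False
      using x unfolding msupport_def by fastforce
  qed
qed

section \<open>Stability of plans and costs under weak limits\<close>

lemma converges_weakly_const: "converges_weakly (\<lambda>_. \<mu>) \<mu>"
  by (simp add: converges_weakly_def)

text \<open>The continuous mapping theorem; applied to \<open>fst\<close> and \<open>snd\<close> it
  shows that the marginals of convergent plans converge.\<close>

lemma converges_weakly_distr:
  fixes f :: "'a::topological_space \<Rightarrow> 'b::topological_space"
  assumes conv: "converges_weakly \<gamma> \<Gamma>" and f: "continuous_on UNIV f"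
    and s: "\<And>n. sets (\<gamma> n) = sets borel" "sets \<Gamma> = sets borel"
  shows "converges_weakly (\<lambda>n. distr (\<gamma> n) borel f) (distr \<Gamma> borel f)"
  unfolding converges_weakly_def
proof (intro allI impI)
  fix h :: "'b \<Rightarrow> real" assume h: "continuous_on UNIV h"
  have hm: "h \<in> borel_measurable borel" and fm: "f \<in> borel_measurable borel"
    by (intro borel_measurable_continuous_onI h f)+
  have eq: "(\<integral>x. h x \<partial>distr \<eta> borel f) = (\<integral>x. h (f x) \<partial>\<eta>)" if "sets \<eta> = sets borel" for \<eta>
    by (rule integral_distr[OF _ hm]) (use fm in \<open>simp add: measurable_cong_sets[OF that refl]\<close>)
  have "continuous_on UNIV (\<lambda>x. h (f x))"
    by (rule continuous_on_compose2[OF h f]) simp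
  from converges_weaklyD[OF conv this]
  show "(\<lambda>n. \<integral>x. h x \<partial>distr (\<gamma> n) borel f) \<longlonglongrightarrow> (\<integral>x. h x \<partial>distr \<Gamma> borel f)"
    by (simp add: eq s)
qed

text \<open>Weak convergence does not control individual sets, so the inequality is first moved to
  continuous test functions, passed to the limit there, and then recovered on sets.\<close>

lemma emeasure_le_weak_limit:
  fixes \<alpha> \<beta> :: "nat \<Rightarrow> 'a::polish_space measure"
  assumes \<alpha>: "\<And>n. \<alpha> n \<in> borel_measures" and \<beta>: "\<And>n. \<beta> n \<in> borel_measures"
    and le: "\<And>n A. A \<in> sets borel \<Longrightarrow> emeasure (\<alpha> n) A \<le> emeasure (\<beta> n) A"
    and \<alpha>': "\<alpha>' \<in> borel_measures" "converges_weakly \<alpha> \<alpha>'"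
    and \<beta>': "\<beta>' \<in> borel_measures" "converges_weakly \<beta> \<beta>'"
    and A: "A \<in> sets borel"
  shows "emeasure \<alpha>' A \<le> emeasure \<beta>' A"
proof (rule emeasure_le_from_integrals[OF \<alpha>'(1) \<beta>'(1) _ A])
  fix h :: "'a \<Rightarrow> real"
  assume h: "continuous_on UNIV h" "\<And>x. 0 \<le> h x" "\<And>x. h x \<le> 1"
  have int: "integrable \<eta> h" if "\<eta> \<in> borel_measures" for \<eta>
    by (rule finite_measure.integrable_const_bound[OF borel_measuresD(3)[OF that], of _ 1])
      (use h borel_measurable_continuous_onI[OF h(1)] in
        \<open>auto simp: measurable_cong_sets[OF borel_measuresD(1)[OF that] refl]\<close>)
  have "(\<integral>x. h x \<partial>\<alpha> n) \<le> (\<integral>x. h x \<partial>\<beta> n)" for n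
  proof -
    have s: "sets (\<alpha> n) = sets (\<beta> n)"
      using borel_measuresD(1)[OF \<alpha>] borel_measuresD(1)[OF \<beta>] by simp
    have "\<alpha> n \<le> \<beta> n"
      unfolding le_measure[OF s] using le borel_measuresD(1)[OF \<alpha>] by simp
    from nn_integral_mono_measure[OF s this, of "\<lambda>x. ennreal (h x)"]
    have "ennreal (\<integral>x. h x \<partial>\<alpha> n) \<le> ennreal (\<integral>x. h x \<partial>\<beta> n)"
      by (simp add: nn_integral_eq_integral int \<alpha> \<beta> h)
    moreover have "0 \<le> (\<integral>x. h x \<partial>\<beta> n)"
      by (simp add: h)
    ultimately show ?thesis by simp
  qed
  then show "(\<integral>x. h x \<partial>\<alpha>') \<le> (\<integral>x. h x \<partial>\<beta>')"
    by (intro LIMSEQ_le[OF converges_weaklyD[OF \<alpha>'(2) h(1)] converges_weaklyD[OF \<beta>'(2) h(1)]]) auto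
qed

text \<open>The first marginal is compared with a constant sequence; for the second, the dominating
  measures move along with the plans, so both sides of the inequality pass to the limit.\<close>

lemma partial_plans_weak_limit:
  fixes \<mu> :: "'a::polish_space measure"
  assumes \<mu>: "\<mu> \<in> borel_measures" and \<rho>: "\<And>n. \<rho> n \<in> borel_measures"
    and \<gamma>: "\<And>n. \<gamma> n \<in> partial_plans \<mu> (\<rho> n)"
    and \<nu>: "\<nu> \<in> borel_measures" "converges_weakly \<rho> \<nu>"
    and \<Gamma>: "\<Gamma> \<in> borel_measures" "converges_weakly \<gamma> \<Gamma>"
  shows "\<Gamma> \<in> partial_plans \<mu> \<nu>"
  unfolding partial_plans_def
proof (intro CollectI conjI ballI \<Gamma>(1))
  have \<gamma>b: "\<gamma> n \<in> borel_measures" for n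
    using \<gamma> by (simp add: partial_plans_def)
  note conv = converges_weakly_distr[OF \<Gamma>(2) _ borel_measuresD(1)[OF \<gamma>b] borel_measuresD(1)[OF \<Gamma>(1)]]
  note distr = borel_measures_distr[OF _ measurable_pair_borel(1)] borel_measures_distr[OF _ measurable_pair_borel(2)]
  fix A :: "'a set" assume A: "A \<in> sets borel"
  have "emeasure (distr \<Gamma> borel fst) A \<le> emeasure \<mu> A"
  proof (rule emeasure_le_weak_limit[where \<alpha> = "\<lambda>n. distr (\<gamma> n) borel fst" and \<beta> = "\<lambda>_. \<mu>"])
    show "emeasure (distr (\<gamma> n) borel fst) B \<le> emeasure \<mu> B" if "B \<in> sets borel" for n B
      using \<gamma>[of n] that by (simp add: partial_plans_def emeasure_distr_fst)
  qed (intro distr \<gamma>b \<Gamma>(1) \<mu> conv converges_weakly_const A continuous_on_fst continuous_on_id)+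
  then show "emeasure \<Gamma> (A \<times> UNIV) \<le> emeasure \<mu> A"
    by (simp add: emeasure_distr_fst \<Gamma>(1) A)
  have "emeasure (distr \<Gamma> borel snd) A \<le> emeasure \<nu> A"
  proof (rule emeasure_le_weak_limit[where \<alpha> = "\<lambda>n. distr (\<gamma> n) borel snd" and \<beta> = \<rho>])
    show "emeasure (distr (\<gamma> n) borel snd) B \<le> emeasure (\<rho> n) B" if "B \<in> sets borel" for n B
      using \<gamma>[of n] that by (simp add: partial_plans_def emeasure_distr_snd)
  qed (intro distr \<gamma>b \<Gamma>(1) \<rho> \<nu> conv A continuous_on_snd continuous_on_id)+
  then show "emeasure \<Gamma> (UNIV \<times> A) \<le> emeasure \<nu> A"
    by (simp add: emeasure_distr_snd \<Gamma>(1) A)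
qed

text \<open>This is convergence and not just semicontinuity, because \<open>converges_weakly\<close>
  admits the squared distance, possibly unbounded, as a test function.\<close>

lemma partial_cost_weak_limit:
  fixes \<mu> :: "'a::polish_space measure"
  assumes "\<And>n. \<rho> n \<in> borel_measures" "\<nu> \<in> borel_measures" "converges_weakly \<rho> \<nu>"
    and "\<And>n. \<gamma> n \<in> borel_measures" "\<Gamma> \<in> borel_measures" "converges_weakly \<gamma> \<Gamma>"
  shows "(\<lambda>n. partial_cost a b \<mu> (\<rho> n) (\<gamma> n)) \<longlonglongrightarrow> partial_cost a b \<mu> \<nu> \<Gamma>"
proof -
  have "continuous_on UNIV (\<lambda>z :: 'a \<times> 'a. (dist (fst z) (snd z))\<^sup>2)"
    by (intro continuous_intros)
  from converges_weaklyD[OF assms(6) this] show ?thesis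
    unfolding partial_cost_def
    by (intro tendsto_intros converges_weakly_mass assms borel_measuresD(1))
qed

section \<open>Mass bounds\<close>

lemma partial_plans_mass_le:
  assumes "\<mu> \<in> borel_measures" "\<gamma> \<in> partial_plans \<mu> \<rho>"
  shows "measure \<gamma> UNIV \<le> measure \<mu> UNIV"
proof -
  have "emeasure \<gamma> (UNIV \<times> UNIV) \<le> emeasure \<mu> UNIV" and \<gamma>: "\<gamma> \<in> borel_measures"
    using assms(2) by (auto simp: partial_plans_def simp del: UNIV_Times_UNIV)
  then have "emeasure \<gamma> UNIV \<le> emeasure \<mu> UNIV" by simp
  then show ?thesis
    by (simp add: finite_measure.emeasure_eq_measure borel_measuresD(3)[OF assms(1)] borel_measuresD(3)[OF \<gamma>])
qed

text \<open>Coercivity: a plan moves at most the mass of \<open>\<mu>\<close>, so any excess mass of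
  \<open>\<rho>\<close> is paid at rate \<open>a\<close>.\<close>

lemma partial_cost_ge:
  assumes "a > 0" "\<mu> \<in> borel_measures" "\<gamma> \<in> partial_plans \<mu> \<rho>"
  shows "a * (measure \<rho> UNIV - measure \<mu> UNIV) \<le> partial_cost a b \<mu> \<rho> \<gamma>"
proof -
  have "a * (measure \<rho> UNIV - measure \<mu> UNIV) \<le>
      a * (measure \<mu> UNIV + measure \<rho> UNIV - 2 * measure \<gamma> UNIV)"
    using partial_plans_mass_le[OF assms(2,3)] \<open>a > 0\<close> by (intro mult_left_mono) auto
  moreover have "0 \<le> b\<^sup>2 * (\<integral>z. (dist (fst z) (snd z))\<^sup>2 \<partial>\<gamma>)"
    by simp
  ultimately show ?thesis
    unfolding partial_cost_def by linarith
qed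

theorem theorem4p2:
  fixes a b :: real and k :: nat
    and \<mu> :: "nat \<Rightarrow> 'a::polish_space measure"
    and lam :: "nat \<Rightarrow> real"
    and K :: "'a set"
  assumes "a > 0" and "b > 0"
    and "locally_compact_space (euclidean :: 'a topology)"
    and "k \<ge> 2"
    and "\<And>i. i \<in> {1..k} \<Longrightarrow> \<mu> i \<in> borel_measures"
    and "\<And>i. i \<in> {1..k} \<Longrightarrow> compact (msupport (\<mu> i))"
    and "\<And>i. i \<in> {1..k} \<Longrightarrow> lam i > 0"
    and "(\<Sum>i=1..k. lam i) = 1"
    and "K = (\<Union>i\<in>{1..k}. msupport (\<mu> i))"
  shows "\<exists>\<nu>. \<nu> \<in> borel_measures \<and> msupport \<nu> \<subseteq> K \<and>
    (\<Sum>i=1..k. lam i * (generalized_W2 a b (\<mu> i) \<nu>)\<^sup>2) =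
      Inf {(\<Sum>i=1..k. lam i * (generalized_W2 a b (\<mu> i) \<rho>)\<^sup>2) | \<rho>.
        \<rho> \<in> borel_measures \<and> msupport \<rho> \<subseteq> K}"
proof -
  note \<mu> = assms(5) and lam = assms(7,8)
  define obj where "obj \<rho> = (\<Sum>i=1..k. lam i * (generalized_W2 a b (\<mu> i) \<rho>)\<^sup>2)" for \<rho>
  define feas where "feas = {\<rho> :: 'a measure. \<rho> \<in> borel_measures \<and> msupport \<rho> \<subseteq> K}"
  have obj_set: "{(\<Sum>i=1..k. lam i * (generalized_W2 a b (\<mu> i) \<rho>)\<^sup>2) | \<rho>.
        \<rho> \<in> borel_measures \<and> msupport \<rho> \<subseteq> K} = obj ` feas"
    by (auto simp: obj_def feas_def)
  have K: "compact K"
    unfolding assms(9) by (rule compact_UN) (use assms(6) in auto)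
  then have KK: "compact (K \<times> K)"
    using K by (rule compact_Times)
  have \<mu>K: "AE x in \<mu> i. x \<in> K" if "i \<in> {1..k}" for i
    by (rule AE_in_superset_msupport[OF \<mu>[OF that]]) (use that assms(9) in blast)
  \<comment> \<open>Together with \<open>ne\<close>, this ensures that \<open>Inf\<close> on the
    reals is a true infimum. The zero measure is feasible, as its support is empty.\<close>
  have bdd: "bdd_below (obj ` feas)"
    by (rule bdd_belowI[of _ 0]) (auto simp: obj_def less_imp_le[OF lam(1)] intro!: sum_nonneg mult_nonneg_nonneg)
  have "null_measure borel \<in> feas"
    by (simp add: feas_def borel_measures_null msupport_def) (auto intro: exI[of _ UNIV])
  then have ne: "obj ` feas \<noteq> {}"
    by blast
  define I where "I = Inf (obj ` feas)"
  \<comment> \<open>The same slack serves twice, for the near-minimality of \<open>\<rho> n\<close>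
    and for the near-optimality of each plan. As the weights sum to 1, the total error is 2
    \<open>\<epsilon> n\<close>, at most 2.\<close>
  define \<epsilon> where "\<epsilon> = (\<lambda>n. inverse (real (Suc n)))"
  have \<epsilon>: "\<epsilon> n > 0" "\<epsilon> n \<le> 1" "\<epsilon> \<longlonglongrightarrow> 0" for n
    using LIMSEQ_inverse_real_of_nat by (simp_all add: \<epsilon>_def inverse_le_1_iff)
  have "\<exists>\<rho>\<in>feas. obj \<rho> < I + \<epsilon> n" for n
    using cInf_lessD[OF ne, of "I + \<epsilon> n"] \<epsilon>(1)[of n] by (auto simp: I_def)
  then obtain \<rho> where \<rho>: "\<And>n. \<rho> n \<in> feas" "\<And>n. obj (\<rho> n) < I + \<epsilon> n"
    by metis
  have \<rho>b: "\<rho> n \<in> borel_measures" for n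
    using \<rho>(1) by (simp add: feas_def)
  have \<rho>K: "AE x in \<rho> n. x \<in> K" for n
    using \<rho>(1) by (intro AE_in_superset_msupport) (auto simp: feas_def)
  have "\<exists>\<gamma>. \<gamma> \<in> partial_plans (\<mu> i) (\<rho> n) \<and>
      partial_cost a b (\<mu> i) (\<rho> n) \<gamma> \<le> (generalized_W2 a b (\<mu> i) (\<rho> n))\<^sup>2 + \<epsilon> n"
    if "i \<in> {1..k}" for i n
    using partial_plan_near_optimal[OF \<open>a > 0\<close> \<mu>[OF that] \<rho>b \<epsilon>(1)] by blast
  then obtain \<gamma> where \<gamma>: "\<And>i n. i \<in> {1..k} \<Longrightarrow> \<gamma> i n \<in> partial_plans (\<mu> i) (\<rho> n)"
    and \<gamma>_cost: "\<And>i n. i \<in> {1..k} \<Longrightarrow>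
      partial_cost a b (\<mu> i) (\<rho> n) (\<gamma> i n) \<le> (generalized_W2 a b (\<mu> i) (\<rho> n))\<^sup>2 + \<epsilon> n"
    by metis
  have \<gamma>b: "\<gamma> i n \<in> borel_measures" if "i \<in> {1..k}" for i n
    using \<gamma>[OF that] by (simp add: partial_plans_def)
  have \<gamma>K: "AE z in \<gamma> i n. z \<in> K \<times> K" if "i \<in> {1..k}" for i n
    by (rule partial_plans_AE[OF compact_imp_closed[OF K] \<gamma>[OF that] \<mu>[OF that] \<mu>K[OF that] \<rho>b \<rho>K])
  have cost: "(\<Sum>i=1..k. lam i * partial_cost a b (\<mu> i) (\<rho> n) (\<gamma> i n)) \<le> I + 2 * \<epsilon> n" for n
  proof -
    have "(\<Sum>i=1..k. lam i * partial_cost a b (\<mu> i) (\<rho> n) (\<gamma> i n)) \<le>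
        (\<Sum>i=1..k. lam i * ((generalized_W2 a b (\<mu> i) (\<rho> n))\<^sup>2 + \<epsilon> n))"
      by (intro sum_mono mult_left_mono \<gamma>_cost less_imp_le[OF lam(1)])
    also have "\<dots> = obj (\<rho> n) + (\<Sum>i=1..k. lam i) * \<epsilon> n"
      by (simp add: obj_def distrib_left sum.distrib sum_distrib_right)
    finally show ?thesis
      using \<rho>(2)[of n] lam(2) by simp
  qed
  \<comment> \<open>Averaging \<open>partial_cost_ge\<close> with the weights, which sum to 1,
    bounds \<open>a\<close> times the excess of the mass of \<open>\<rho> n\<close> over the
    averaged mass of the \<open>\<mu> i\<close> by I + 2.\<close>
  define M where "M = (I + 2) / a + (\<Sum>i=1..k. lam i * measure (\<mu> i) UNIV)"
  have M: "measure (\<rho> n) UNIV \<le> M" for n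
  proof -
    have "a * (measure (\<rho> n) UNIV - (\<Sum>i=1..k. lam i * measure (\<mu> i) UNIV)) =
        (\<Sum>i=1..k. lam i) * (a * measure (\<rho> n) UNIV) - a * (\<Sum>i=1..k. lam i * measure (\<mu> i) UNIV)"
      using lam(2) by (simp add: algebra_simps)
    also have "\<dots> = (\<Sum>i=1..k. lam i * (a * (measure (\<rho> n) UNIV - measure (\<mu> i) UNIV)))"
      by (simp add: sum_distrib_left sum_distrib_right sum_subtractf algebra_simps)
    also have "\<dots> \<le> (\<Sum>i=1..k. lam i * partial_cost a b (\<mu> i) (\<rho> n) (\<gamma> i n))"
      by (intro sum_mono mult_left_mono partial_cost_ge \<open>a > 0\<close> \<mu> \<gamma> less_imp_le[OF lam(1)])
    also have "\<dots> \<le> I + 2"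
      using cost[of n] \<epsilon>(2)[of n] by linarith
    finally show ?thesis
      using \<open>a > 0\<close> by (simp add: M_def field_simps)
  qed
  obtain r1 \<nu> where r1: "strict_mono (r1 :: nat \<Rightarrow> nat)" and \<nu>: "\<nu> \<in> borel_measures"
    "AE x in \<nu>. x \<in> K" "converges_weakly (\<lambda>n. \<rho> (r1 n)) \<nu>"
    using finite_compact_subsequence[of K \<rho>, OF K \<rho>b \<rho>K M] by blast
  \<comment> \<open>The plans have masses bounded by those of the fixed \<open>\<mu> i\<close>. The
    extraction by itself says nothing about how the limits \<open>\<Gamma> i\<close> relate to
    \<open>\<nu>\<close>; this is recovered from stability of the marginal bounds.\<close>
  have "\<exists>r \<Gamma>. strict_mono (r :: nat \<Rightarrow> nat) \<and> (\<forall>i\<in>{1..k}. \<Gamma> i \<in> borel_measures \<and>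
    (AE z in \<Gamma> i. z \<in> K \<times> K) \<and> converges_weakly (\<lambda>n. \<gamma> i (r1 (r n))) (\<Gamma> i))"
    using finite_family_compact_subsequence[where I = "{1..k}" and K = "K \<times> K"
        and \<gamma> = "\<lambda>i n. \<gamma> i (r1 n)" and M = "\<lambda>i. measure (\<mu> i) UNIV",
        OF finite_atLeastAtMost KK \<gamma>b \<gamma>K partial_plans_mass_le[OF \<mu> \<gamma>]] .
  then obtain r2 \<Gamma> where r2: "strict_mono (r2 :: nat \<Rightarrow> nat)"
    and \<Gamma>: "\<And>i. i \<in> {1..k} \<Longrightarrow> \<Gamma> i \<in> borel_measures"
      "\<And>i. i \<in> {1..k} \<Longrightarrow> converges_weakly (\<lambda>n. \<gamma> i (r1 (r2 n))) (\<Gamma> i)"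
    by blast
  note \<nu>_conv = converges_weakly_subseq[OF \<nu>(3) r2]
  have \<Gamma>_plan: "\<Gamma> i \<in> partial_plans (\<mu> i) \<nu>" if "i \<in> {1..k}" for i
    by (rule partial_plans_weak_limit[OF \<mu>[OF that] \<rho>b \<gamma>[OF that] \<nu>(1) \<nu>_conv \<Gamma>[OF that]])
  \<comment> \<open>The limit plans need not be known to be optimal for \<open>\<nu>\<close>: any
    admissible plan bounds the objective from above, and their cost is the limit of costs that
    approach \<open>I\<close>.\<close>
  have "obj \<nu> \<le> (\<Sum>i=1..k. lam i * partial_cost a b (\<mu> i) \<nu> (\<Gamma> i))"
    unfolding obj_def
    by (intro sum_mono mult_left_mono less_imp_le[OF lam(1)]
        generalized_W2_le_partial_cost[OF \<open>a > 0\<close> K \<Gamma>_plan \<mu> \<mu>K \<nu>(1,2)])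
  also have "\<dots> \<le> I"
  proof (rule LIMSEQ_le)
    show "(\<lambda>n. \<Sum>i=1..k. lam i * partial_cost a b (\<mu> i) (\<rho> (r1 (r2 n))) (\<gamma> i (r1 (r2 n))))
        \<longlonglongrightarrow> (\<Sum>i=1..k. lam i * partial_cost a b (\<mu> i) \<nu> (\<Gamma> i))"
      by (intro tendsto_sum tendsto_mult_left partial_cost_weak_limit \<rho>b \<gamma>b \<nu>(1) \<Gamma> \<nu>_conv)
    have "strict_mono (\<lambda>n. r1 (r2 n))"
      using r1 r2 by (simp add: strict_mono_def)
    from LIMSEQ_subseq_LIMSEQ[OF \<epsilon>(3) this]
    have "(\<lambda>n. I + 2 * \<epsilon> (r1 (r2 n))) \<longlonglongrightarrow> I + 2 * 0"
      by (intro tendsto_intros) (simp add: o_def)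
    then show "(\<lambda>n. I + 2 * \<epsilon> (r1 (r2 n))) \<longlonglongrightarrow> I"
      by simp
  qed (use cost in blast)
  finally have "obj \<nu> \<le> I" .
  moreover have "\<nu> \<in> feas"
    using \<nu>(1) msupport_subset_closed[OF \<nu>(1) compact_imp_closed[OF K] \<nu>(2)] by (simp add: feas_def)
  moreover from this have "I \<le> obj \<nu>"
    unfolding I_def by (intro cInf_lower bdd) simp
  ultimately show ?thesis
    unfolding obj_set by (intro exI[of _ \<nu>]) (auto simp: feas_def I_def obj_def)
qed

end
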